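(* Let $\varphi=\frac{\sqrt5-1}{2}=[0;\overline{1}]$ and let $$\mu_{\max}=1+\varphi,\quad \mu_2=1+2\varphi^3,\quad \mu_3=1+\frac{\varphi^2(\varphi^4+\varphi^2+1)}{\varphi^5+\varphi^3+1},\quad \mu_4=1+\frac{1-\varphi^6}{1+2\varphi-2\varphi^7+\varphi^{11}},\quad \mu_{\min}=1+\varphi^2.$$ For each $\alpha\in\{\mu_{\max},\mu_2,\mu_3\}$, there are only countably many Sturmian words $\mathbf{x}$ of slope $\varphi$ satisfying $\operatorname{rep}(\mathbf{x})=\alpha$. For each $\beta\in\{\mu_4,\mu_{\min}\}$, there are uncountably many Sturmian words $\mathbf{x}$ of slope $\varphi$ satisfying $\operatorname{rep}(\mathbf{x})=\beta$.
   Context: Sturmian words: for an irrational $\theta\in(0,1)$, a Sturmian word of slope $\theta$ is an infinite word $\mathbf{x}=x_1x_2\dots$ over $\{0,1\}$ for which there is a real $\rho$ such that either $x_n=\lfloor (n+1)\theta+\rho\rfloor-\lfloor n\theta+\rho\rfloor$ for all $n\ge1$, or $x_n=\lceil (n+1)\theta+\rho\rceil-\lceil n\theta+\rho\rceil$ for all $n\ge1$. Exponent of repetition: for an infinite word $\mathbf{x}=x_1x_2\dots$ and $n\ge1$, $r(n,\mathbf{x})=\min\{m : x_j\dots x_{j+n-1}=x_{m-n+1}\dots x_m\text{ for some }1\le j\le m-n\}$, and $\operatorname{rep}(\mathbf{x})=\liminf_{n\to\infty} r(n,\mathbf{x})/n$. *)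

theory Defs
  imports "HOL-Analysis.Analysis"
begin

text \<open>
  An infinite word \<open>x\<^sub>1 x\<^sub>2 \<dots>\<close> is a function \<open>x :: nat \<Rightarrow> 'a\<close> with \<open>x k = x\<^sub>k\<^sub>+\<^sub>1\<close>.
  Starting at index 0 leaves no unused argument, so distinct functions are distinct words
  and cardinalities of sets of functions are cardinalities of sets of words.
\<close>

definition sturmian_word :: "real \<Rightarrow> (nat \<Rightarrow> int) \<Rightarrow> bool" where
  "sturmian_word \<theta> x \<longleftrightarrow>
     \<theta> \<notin> \<rat> \<and> 0 < \<theta> \<and> \<theta> < 1 \<and> range x \<subseteq> {0, 1} \<and>
     (\<exists>\<rho>::real.
        (\<forall>n\<ge>1. x (n - 1) = \<lfloor>real (n + 1) * \<theta> + \<rho>\<rfloor> - \<lfloor>real n * \<theta> + \<rho>\<rfloor>) \<or>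
        (\<forall>n\<ge>1. x (n - 1) = \<lceil>real (n + 1) * \<theta> + \<rho>\<rceil> - \<lceil>real n * \<theta> + \<rho>\<rceil>))"

text \<open>
  \<open>factor x i j\<close> is \<open>x\<^sub>i \<dots> x\<^sub>j\<close>, both ends included, for \<open>1 \<le> i\<close>.
\<close>
definition factor :: "(nat \<Rightarrow> 'a) \<Rightarrow> nat \<Rightarrow> nat \<Rightarrow> 'a list" where
  "factor x i j = map (\<lambda>k. x (k - 1)) [i..<Suc j]"

text \<open>
  The minimum is over a nonempty set whenever \<open>x\<close> takes finitely many values, by the
  pigeonhole principle. If \<open>m < n\<close>, truncated subtraction gives \<open>m - n = 0\<close>, which
  correctly leaves no admissible \<open>j\<close>; and \<open>j + n - 1\<close> does not truncate since \<open>1 \<le> j\<close>.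
\<close>
definition rep_fun :: "nat \<Rightarrow> (nat \<Rightarrow> 'a) \<Rightarrow> nat" where
  "rep_fun n x =
     (LEAST m. \<exists>j. 1 \<le> j \<and> j \<le> m - n \<and>
        factor x j (j + n - 1) = factor x (m - n + 1) m)"

definition rep :: "(nat \<Rightarrow> 'a) \<Rightarrow> ereal" where
  "rep x = liminf (\<lambda>n. ereal (real (rep_fun n x) / real n))"

definition phi :: real where
  "phi = (sqrt 5 - 1) / 2"

definition mu_max :: real where
  "mu_max = 1 + phi"

definition mu_2 :: real where
  "mu_2 = 1 + 2 * phi ^ 3"

definition mu_3 :: real where
  "mu_3 = 1 + phi ^ 2 * (phi ^ 4 + phi ^ 2 + 1) / (phi ^ 5 + phi ^ 3 + 1)"

definition mu_4 :: real where
  "mu_4 = 1 + (1 - phi ^ 6) / (1 + 2 * phi - 2 * phi ^ 7 + phi ^ 11)"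

definition mu_min :: real where
  "mu_min = 1 + phi ^ 2"

end

theory Submission
  imports Defs "HOL-Number_Theory.Fib"
begin

text \<open>
  A word of slope \<open>phi\<close> codes an orbit \<open>y + t phi\<close> of the golden rotation. Its windows at \<open>j\<close> and
  \<open>j + p\<close> agree as long as the orbit avoids an interval of length \<open>\<parallel>p phi\<parallel>\<close> at the origin; for a
  repetition that matters, \<open>p\<close> is a Fibonacci number. Renormalizing the rotation at the origin encodes
  \<open>y\<close> by an itinerary in \<open>{A, B}\<close> without two consecutive \<open>B\<close>, where the renormalized points satisfy
  \<open>w\<^sub>i = - phi (w\<^sub>i\<^sub>+\<^sub>1 + d\<^sub>i)\<close> with \<open>d\<^sub>i = 1\<close> at each \<open>AA\<close> and \<open>d\<^sub>i = 0\<close> otherwise. With \<open>\<tau>\<^sub>0 = 0\<close> and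
  \<open>\<tau>\<^sub>i\<^sub>+\<^sub>1 = phi (\<tau>\<^sub>i + d\<^sub>i)\<close>, \<open>rep - 1\<close> is the liminf of \<open>phi\<^sup>2 (1 + \<tau>\<^sub>i)\<close> over the \<open>AA\<close> and of
  \<open>1 / (\<tau>\<^sub>i + 1 + phi)\<close> over the \<open>B\<close>, capped at \<open>phi\<close>.

  If \<open>rep > 1.4395\<close>, these constraints force the itinerary to end in \<open>A\<close>, \<open>AAB\<close> or \<open>AAABAB\<close> repeated, so
  \<open>y\<close> lies in a countable set; this covers \<open>mu_max\<close>, \<open>mu_2\<close> and \<open>mu_3\<close>. Itineraries with sparse
  \<open>B\<close> give \<open>mu_min\<close>, and itineraries \<open>AAABAB AAABAB \<dots>\<close> with sparse insertions of \<open>AAB\<close> give \<open>mu_4\<close>;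
  the positions of the sparse letters can be chosen in uncountably many ways.
\<close>

subsection \<open>The golden ratio and Fibonacci numbers\<close>

text \<open>The point \<open>0\<close> cuts \<open>(- phi, phi ^ 2)\<close> into pieces whose
  lengths are the two displacements \<open>phi\<close> and \<open>phi ^ 2\<close> of short returns,
  and the signed scale \<open>(- phi) ^ i\<close> makes all levels look alike. This is why one
  recursion with a single binary digit serves every level. A period counts only if its displacement
  carries no point of the window across an integer. The integer combinations of two consecutive
  convergents turn this into a sign discussion, which leaves one Fibonacci period per level; that is
  why two quotients per level and a cap determine the liminf. The threshold 1.4395 separates
  \<open>mu_4\<close> = 1.4347... from \<open>mu_3\<close> = 1.4400.... The three countable values
  only need to lie above it, so their exponents are never computed; for the other two the exponent
  is computed exactly along every itinerary of a family. Points whose forward orbit meets an integer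
  have no itinerary here. They are countable, as are the ceiling words that they produce, so they
  are added in the countable half and removed in the uncountable half.\<close>

lemma phi_square: "phi ^ 2 = 1 - phi"
  unfolding phi_def by (simp add: power2_eq_square field_simps)

lemma phi_square': "phi * phi = 1 - phi"
  using phi_square by (simp add: power2_eq_square)

lemma phi_bounds: "phi > 61803 / 100000" "phi < 61804 / 100000"
proof -
  have "sqrt 5 > 223606 / 100000" by (rule real_less_rsqrt) (simp add: power2_eq_square)
  moreover have "sqrt 5 < 223608 / 100000" by (rule real_less_lsqrt) (simp_all add: power2_eq_square)
  ultimately show "phi > 61803 / 100000" "phi < 61804 / 100000" unfolding phi_def by auto
qed

lemma phi_pos [simp]: "phi > 0" and phi_less_1 [simp]: "phi < 1"
  and phi_le_1 [simp]: "phi \<le> 1" and phi_nonneg [simp]: "phi \<ge> 0" and phi_nonzero [simp]: "phi \<noteq> 0"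
  using phi_bounds by auto

lemma phi_power_Suc_Suc: "phi ^ Suc (Suc n) = phi ^ n - phi ^ Suc n"
proof -
  have "phi ^ Suc (Suc n) = phi ^ n * phi ^ 2" by (simp add: power2_eq_square)
  then show ?thesis by (simp add: phi_square algebra_simps)
qed

lemma phi_powers:
  "phi ^ 3 = 2 * phi - 1" "phi ^ 4 = 2 - 3 * phi" "phi ^ 5 = 5 * phi - 3"
  "phi ^ 6 = 5 - 8 * phi" "phi ^ 7 = 13 * phi - 8" "phi ^ 11 = 89 * phi - 55"
  using phi_power_Suc_Suc[of 0] phi_power_Suc_Suc[of 1] phi_power_Suc_Suc[of 2]
    phi_power_Suc_Suc[of 3] phi_power_Suc_Suc[of 4] phi_power_Suc_Suc[of 5]
    phi_power_Suc_Suc[of 6] phi_power_Suc_Suc[of 7] phi_power_Suc_Suc[of 8]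
    phi_power_Suc_Suc[of 9]
  by (simp_all add: eval_nat_numeral)

lemma inverse_phi: "inverse phi = 1 + phi"
  using phi_square' by (simp add: field_simps)

text \<open>
  The denominator of the \<open>i\<close>-th convergent of \<^term>\<open>phi\<close> is \<open>fib (Suc i)\<close>, its numerator
  is \<open>fib i\<close>.
\<close>
lemma fib_Suc_mult_phi: "real (fib (Suc i)) * phi - real (fib i) = phi * (- phi) ^ i"
proof (induction i rule: fib.induct)
  case 2
  then show ?case using phi_square' by simp
next
  case (3 n)
  have "real (fib (Suc (Suc (Suc n)))) * phi - real (fib (Suc (Suc n)))
      = phi * (- phi) ^ Suc n + phi * (- phi) ^ n"
    unfolding 3[symmetric] by (simp add: algebra_simps)
  also have "\<dots> = phi * (- phi) ^ n * (1 - phi)" by (simp add: algebra_simps)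
  also have "\<dots> = phi * (- phi) ^ Suc (Suc n)" unfolding phi_square'[symmetric] by simp
  finally show ?case .
qed simp

lemma fib_Suc_pos [simp]: "fib (Suc i) > 0"
  by (simp add: fib_neq_0_nat)

text \<open>With denominator \<open>b\<close>, the number
  \<open>b * (fib (Suc i) * phi - fib i)\<close> would be a nonzero integer, yet it becomes smaller
  than 1 in absolute value for large \<open>i\<close>.\<close>

lemma phi_not_rat: "phi \<notin> \<rat>"
proof
  assume "phi \<in> \<rat>"
  then obtain a b :: int where b: "b > 0" and phi: "phi = of_int a / of_int b"
    by (metis Rats_cases')
  obtain i where i: "phi ^ i < 1 / of_int b"
    using real_arch_pow_inv[of "1 / of_int b" phi] b by auto
  define z where "z = int (fib (Suc i)) * a - int (fib i) * b"
  have "of_int z = of_int b * (real (fib (Suc i)) * phi - real (fib i))"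
    using b by (simp add: z_def phi field_simps)
  then have z: "of_int z = of_int b * (phi * (- phi) ^ i)" by (simp only: fib_Suc_mult_phi)
  then have "z \<noteq> 0" using b by auto
  moreover have "\<bar>of_int z :: real\<bar> < 1"
  proof -
    have "\<bar>of_int z\<bar> = of_int b * phi ^ i * phi"
      using b by (simp add: z abs_mult power_abs)
    also have "\<dots> < 1 * 1"
      using i b by (intro mult_strict_mono) (auto simp: field_simps)
    finally show ?thesis by simp
  qed
  ultimately show False by linarith
qed

text \<open>Two consecutive convergents have determinant 1 or -1, so the pairs (denominator,
  numerator) form a basis of the integer lattice. The induction step is the change to the next
  basis.\<close>

lemma lattice_basis:
  fixes p q :: int
  obtains a b :: int where "p = a * int (fib (Suc i)) + b * int (fib (Suc (Suc i)))"
    "of_int p * phi - of_int q = phi * (- phi) ^ i * (of_int a - phi * of_int b)"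
proof -
  have "\<exists>a b. p = a * int (fib (Suc i)) + b * int (fib (Suc (Suc i))) \<and>
    q = a * int (fib i) + b * int (fib (Suc i))"
  proof (induction i)
    case 0
    show ?case by (rule exI[of _ "p - q"], rule exI[of _ q]) simp
  next
    case (Suc i)
    then obtain a b where ab: "p = a * int (fib (Suc i)) + b * int (fib (Suc (Suc i)))"
      "q = a * int (fib i) + b * int (fib (Suc i))" by blast
    show ?case
      by (rule exI[of _ "b - a"], rule exI[of _ a]) (simp add: ab algebra_simps)
  qed
  then obtain a b where p: "p = a * int (fib (Suc i)) + b * int (fib (Suc (Suc i)))"
    and q: "q = a * int (fib i) + b * int (fib (Suc i))" by blast
  have "of_int p * phi - of_int q =
      of_int a * (real (fib (Suc i)) * phi - real (fib i)) +
      of_int b * (real (fib (Suc (Suc i))) * phi - real (fib (Suc i)))"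
    by (simp add: p q algebra_simps)
  also have "\<dots> = phi * (- phi) ^ i * (of_int a - phi * of_int b)"
    unfolding fib_Suc_mult_phi by (simp add: algebra_simps)
  finally show ?thesis using that p by blast
qed

text \<open>The two return times to an interval of length \<open>phi + phi ^ 2 = 1\<close> in the
  scaled coordinate. In the lattice basis, coefficients of equal sign make \<open>p\<close> too
  large or nonpositive, opposite signs make the displacement too long, and only the basis vectors
  themselves survive.\<close>

lemma small_displacement:
  fixes u u' :: real and p :: nat and q :: int
  assumes u: "- phi < u" "u < phi ^ 2" "- phi < u'" "u' < phi ^ 2"
    and p: "0 < p" "p < fib (Suc (Suc (Suc i)))"
    and disp: "real p * phi - of_int q = (u' - u) * (- phi) ^ i"
  shows "p = fib (Suc i) \<and> u' = u + phi \<or> p = fib (Suc (Suc i)) \<and> u' = u - phi ^ 2"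
proof -
  obtain a b :: int where pab: "int p = a * int (fib (Suc i)) + b * int (fib (Suc (Suc i)))"
    and e: "of_int (int p) * phi - of_int q = phi * (- phi) ^ i * (of_int a - phi * of_int b)"
    using lattice_basis by blast
  have "(u' - u) * (- phi) ^ i = (phi * (of_int a - phi * of_int b)) * (- phi) ^ i"
    using e disp by (simp add: mult_ac)
  then have d: "u' - u = phi * (of_int a - phi * of_int b)" by simp
  have "\<bar>phi * (of_int a - phi * of_int b)\<bar> < 1"
    unfolding d[symmetric] using u phi_square by linarith
  then have "phi * \<bar>of_int a - phi * of_int b\<bar> < 1"
    by (metis abs_mult abs_of_pos phi_pos)
  then have "\<bar>of_int a - phi * of_int b\<bar> < inverse phi"
    using phi_pos by (metis inverse_eq_divide mult.commute pos_less_divide_eq)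
  then have ab: "\<bar>of_int a - phi * of_int b\<bar> < 1 + phi" by (simp add: inverse_phi)
  have f: "int (fib (Suc i)) > 0" "int (fib (Suc (Suc i))) \<ge> int (fib (Suc i))" by auto
  consider "a \<ge> 1" "b \<ge> 1" | "a \<le> 0" "b \<le> 0" | "a \<ge> 1" "b \<le> -1" | "a \<ge> 1" "b = 0"
    | "a \<le> -1" "b \<ge> 1" | "a = 0" "b \<ge> 1" by linarith
  then show ?thesis
  proof cases
    case 1
    have "int p \<ge> 1 * int (fib (Suc i)) + 1 * int (fib (Suc (Suc i)))"
      unfolding pab using 1 f by (intro add_mono mult_right_mono) auto
    then show ?thesis using p by simp
  next
    case 2
    have "int p \<le> 0"
      unfolding pab using 2 f by (intro add_nonpos_nonpos mult_nonpos_nonneg) auto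
    then show ?thesis using p by simp
  next
    case 3
    have "phi * of_int b \<le> phi * (-1)" using 3 by (intro mult_left_mono) auto
    moreover have "(of_int a :: real) \<ge> 1" using 3 by simp
    ultimately show ?thesis using ab by linarith
  next
    case 4
    then have "of_int a < (2 :: real)" using ab phi_less_1 by (smt (verit) mult_eq_0_iff of_int_0)
    then have "a = 1" using 4 by linarith
    then show ?thesis using 4 pab d by simp
  next
    case 5
    have "phi * of_int b \<ge> phi * 1" using 5 by (intro mult_left_mono) auto
    moreover have "(of_int a :: real) \<le> -1" using 5 by linarith
    ultimately show ?thesis using ab by linarith
  next
    case 6
    have "b = 1"
    proof (rule ccontr)
      assume "b \<noteq> 1"
      then have "b \<ge> 2" using 6 by simp
      then have "b * int (fib (Suc (Suc i))) \<ge> 2 * int (fib (Suc (Suc i)))"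
        by (rule mult_right_mono) simp
      then have "int p \<ge> 2 * int (fib (Suc (Suc i)))" unfolding pab using 6 by simp
      then show False using p by simp
    qed
    then show ?thesis using 6 pab d by (simp add: power2_eq_square)
  qed
qed

subsection \<open>Renormalization of orbits of the golden rotation\<close>

definition generic :: "real \<Rightarrow> bool" where
  "generic y \<longleftrightarrow> (\<forall>n::nat. real n * phi + y \<notin> \<int>)"

lemma genericD: "generic y \<Longrightarrow> real n * phi + y \<noteq> of_int N"
  unfolding generic_def by (metis Ints_of_int)

lemma generic_shift: "generic y \<Longrightarrow> generic (real j * phi + y)"
  unfolding generic_def by (metis add.assoc distrib_right of_nat_add)

text \<open>The digit is 1 exactly when the entry point of level \<open>i\<close> lies outside the
  next, smaller interval. One return of time \<open>fib (Suc i)\<close> then brings it inside, which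
  is the time that \<open>entry_time\<close> adds.\<close>

definition step_digit :: "(nat \<Rightarrow> bool) \<Rightarrow> nat \<Rightarrow> nat" where
  "step_digit A i = of_bool (A i \<and> A (Suc i))"

primrec entry_time :: "(nat \<Rightarrow> bool) \<Rightarrow> nat \<Rightarrow> nat" where
  "entry_time A 0 = 0"
| "entry_time A (Suc i) = entry_time A i + step_digit A i * fib (Suc i)"

text \<open>
  In the coordinate \<open>u\<close> with \<open>z = u (- phi)^i\<close>, the \<open>i\<close>-th induction interval around \<open>0\<close>
  is \<open>(- phi, phi\<^sup>2)\<close>, and \<open>w i\<close> is the place where the orbit of \<open>y\<close> first enters it.
  \<open>A i\<close> says that this happens in the larger part \<open>(- phi, 0)\<close>.
\<close>
locale renormalization =
  fixes y :: real and A :: "nat \<Rightarrow> bool" and w :: "nat \<Rightarrow> real"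
  assumes start: "\<exists>N::int. y - of_int N = w 0"
    and range: "- phi < w i" "w i < phi ^ 2"
    and nonzero: "w i \<noteq> 0"
    and sign: "A i \<longleftrightarrow> w i < 0"
    and rec: "w i = - phi * (w (Suc i) + real (step_digit A i))"

text \<open>At a hit, \<open>fib (Suc i)\<close> further steps carry the point across an integer,
  since \<open>u < 0 < u + phi\<close>. Hits are therefore the obstructions to the period
  \<open>fib (Suc i)\<close>.\<close>

definition hit :: "real \<Rightarrow> nat \<Rightarrow> nat \<Rightarrow> bool" where
  "hit y i t \<longleftrightarrow> (\<exists>N::int. \<exists>u. real t * phi + y - of_int N = u * (- phi) ^ i \<and> - phi < u \<and> u < 0)"

definition hit_outer :: "real \<Rightarrow> nat \<Rightarrow> nat \<Rightarrow> bool" where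
  "hit_outer y i t \<longleftrightarrow>
     (\<exists>N::int. \<exists>u. real t * phi + y - of_int N = u * (- phi) ^ i \<and> - phi < u \<and> u < phi ^ 2)"

lemma hit_imp_hit_outer: "hit y i t \<Longrightarrow> hit_outer y i t"
  unfolding hit_def hit_outer_def by (meson less_trans phi_pos zero_less_power)

lemma hit_shift: "hit (real j * phi + y) i t \<longleftrightarrow> hit y i (j + t)"
  unfolding hit_def by (simp add: algebra_simps)

text \<open>The change of scale \<open>u\<close> to \<open>- phi * u\<close> nests the interval of
  level \<open>Suc i\<close> in that of level \<open>i\<close>, with the same right end.\<close>

lemma hit_outer_Suc: "hit_outer y (Suc i) t \<Longrightarrow> \<exists>N::int. \<exists>u. real t * phi + y - of_int N = u * (- phi) ^ i
    \<and> - (phi ^ 3) < u \<and> u < phi ^ 2"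
proof -
  assume "hit_outer y (Suc i) t"
  then obtain N :: int and u where u: "real t * phi + y - of_int N = u * (- phi) ^ Suc i"
    "- phi < u" "u < phi ^ 2" unfolding hit_outer_def by blast
  have "phi * (- u) < phi * phi" "phi * u < phi * phi ^ 2"
    using u(2,3) by (intro mult_strict_left_mono; simp)+
  then have "- (phi ^ 3) < - phi * u" "- phi * u < phi ^ 2"
    by (simp_all add: power2_eq_square power3_eq_cube mult_ac)
  moreover have "real t * phi + y - of_int N = (- phi * u) * (- phi) ^ i" using u(1) by simp
  ultimately show ?thesis by blast
qed

lemma small_cube: "phi ^ 3 < phi"
  using power_strict_decreasing[of 1 3 phi] by simp

text \<open>An open interval of length at most 1 contains no two points that differ by a nonzero
  integer.\<close>

lemma displacement_unique:
  fixes N N' :: int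
  assumes "z - of_int N = u * (- phi) ^ i" "z - of_int N' = u' * (- phi) ^ i"
    and u: "- phi < u" "u < phi ^ 2" "- phi < u'" "u' < phi ^ 2"
  shows "u = u'"
proof -
  have "\<bar>u - u'\<bar> < 1" using u phi_square by linarith
  have "of_int (N' - N) = (u - u') * (- phi) ^ i"
    using assms(1,2) by (simp add: algebra_simps)
  then have "\<bar>of_int (N' - N)\<bar> = \<bar>u - u'\<bar> * phi ^ i"
    by (metis abs_minus_cancel abs_mult abs_of_pos phi_pos power_abs of_int_abs)
  also have "\<dots> \<le> \<bar>u - u'\<bar> * 1" by (intro mult_left_mono power_le_one) auto
  also have "\<dots> < 1" using \<open>\<bar>u - u'\<bar> < 1\<close> by simp
  finally have "N = N'" by linarith
  then show ?thesis using assms(1,2) by simp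
qed

lemma hit_times_displacement:
  assumes t: "t < t'" "t' < t + fib (Suc (Suc (Suc i)))"
    and h: "real t * phi + y - of_int N = u * (- phi) ^ i" "real t' * phi + y - of_int N' = u' * (- phi) ^ i"
    and u: "- phi < u" "u < phi ^ 2" "- phi < u'" "u' < phi ^ 2"
  shows "t' = t + fib (Suc i) \<and> u' = u + phi \<or> t' = t + fib (Suc (Suc i)) \<and> u' = u - phi ^ 2"
proof -
  have e: "real (t' - t) * phi - of_int (N' - N) = (u' - u) * (- phi) ^ i"
    using h t by (simp add: of_nat_diff algebra_simps)
  have "0 < t' - t" "t' - t < fib (Suc (Suc (Suc i)))" using t by linarith+
  from small_displacement[OF u this e] show ?thesis using t by linarith
qed

context renormalization
begin

abbreviation "d \<equiv> step_digit A"
abbreviation "s \<equiv> entry_time A"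

lemma digit_1: "A i \<Longrightarrow> A (Suc i) \<Longrightarrow> w i < - (phi ^ 3)"
proof -
  assume "A i" "A (Suc i)"
  then have wi: "w i = - (phi * (w (Suc i) + 1))" using rec[of i] by (simp add: step_digit_def)
  have "phi * phi ^ 2 < phi * (w (Suc i) + 1)"
    using range[of "Suc i"] phi_square by (intro mult_strict_left_mono) auto
  then show ?thesis unfolding wi by (simp add: power2_eq_square power3_eq_cube mult.assoc)
qed

lemma digit_0: "A i \<Longrightarrow> \<not> A (Suc i) \<Longrightarrow> - (phi ^ 3) < w i"
proof -
  assume "A i" "\<not> A (Suc i)"
  then have wi: "w i = - (phi * w (Suc i))" using rec[of i] by (simp add: step_digit_def)
  have "phi * w (Suc i) < phi * phi ^ 2"
    using range[of "Suc i"] by (intro mult_strict_left_mono) auto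
  then show ?thesis unfolding wi by (simp add: power2_eq_square power3_eq_cube mult.assoc)
qed

text \<open>A positive point has digit 0, and the recursion then only flips the sign and rescales.
  This is what forbids \<open>BB\<close>.\<close>

lemma after_not_A: "\<not> A i \<Longrightarrow> A (Suc i)"
proof -
  assume "\<not> A i"
  then have "d i = 0" by (simp add: step_digit_def)
  then have "w i = phi * (- w (Suc i))" using rec[of i] by simp
  moreover have "w i > 0" using \<open>\<not> A i\<close> sign[of i] nonzero[of i] by linarith
  ultimately have "0 < phi * (- w (Suc i))" by metis
  then have "0 < - w (Suc i)" by (rule zero_less_mult_pos) simp
  then show ?thesis using sign[of "Suc i"] by simp
qed

lemma entry_point: "\<exists>N::int. real (s i) * phi + y - of_int N = w i * (- phi) ^ i"
proof (induction i)
  case 0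
  then show ?case using start by simp
next
  case (Suc i)
  then obtain N :: int where N: "real (s i) * phi + y - of_int N = w i * (- phi) ^ i" by blast
  have "real (s (Suc i)) * phi + y - of_int (N + int (d i) * int (fib i))
      = real (s i) * phi + y - of_int N + real (d i) * (real (fib (Suc i)) * phi - real (fib i))"
    by (simp add: algebra_simps)
  also have "\<dots> = (w i + real (d i) * phi) * (- phi) ^ i"
    unfolding N fib_Suc_mult_phi by (simp add: algebra_simps)
  also have "w i + real (d i) * phi = - phi * w (Suc i)" using rec[of i] by (simp add: algebra_simps)
  also have "- phi * w (Suc i) * (- phi) ^ i = w (Suc i) * (- phi) ^ Suc i" by simp
  finally show ?case by blast
qed

text \<open>Makes \<open>s i\<close> the first entry time. Entering level \<open>Suc i\<close>
  entails entering level \<open>i\<close>, so only times from \<open>s i\<close> on matter; if the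
  digit is 1, the point at \<open>s i\<close> is still outside and no return is faster than
  \<open>fib (Suc i)\<close>.\<close>

lemma no_outer_hit_before: "t < s i \<Longrightarrow> \<not> hit_outer y i t"
proof (induction i arbitrary: t)
  case (Suc i)
  show ?case
  proof
    assume "hit_outer y (Suc i) t"
    then obtain N :: int and u where u: "real t * phi + y - of_int N = u * (- phi) ^ i"
      "- (phi ^ 3) < u" "u < phi ^ 2" using hit_outer_Suc by blast
    have u': "- phi < u" using u small_cube by linarith
    then have "hit_outer y i t" unfolding hit_outer_def using u by blast
    then have ge: "t \<ge> s i" using Suc.IH not_less by blast
    have "A i \<and> A (Suc i)"
    proof (rule ccontr)
      assume "\<not> (A i \<and> A (Suc i))"
      then have "d i = 0" by (auto simp: step_digit_def)
      then show False using Suc.prems ge by simp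
    qed
    then have wi: "w i < - (phi ^ 3)" and t: "t < s i + fib (Suc i)"
      using digit_1 Suc.prems by (auto simp: step_digit_def)
    obtain N' where N': "real (s i) * phi + y - of_int N' = w i * (- phi) ^ i"
      using entry_point by blast
    show False
    proof (cases "t = s i")
      case True
      then have "u = w i" using displacement_unique[OF u(1)] N' u' u(3) range by blast
      then show False using wi u(2) by simp
    next
      case False
      then have st: "s i < t" "t < s i + fib (Suc (Suc (Suc i)))" using ge t by simp_all
      have "t < s i + fib (Suc (Suc i))" using t by simp
      with hit_times_displacement[OF st N' u(1) range u' u(3)] t show False by linarith
    qed
  qed
qed simp

lemma hit_entry: "A i \<Longrightarrow> hit y i (s i)"
  unfolding hit_def using entry_point range sign by blast

text \<open>Here \<open>w i < - (phi ^ 3)\<close>, so the two short returns lead to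
  \<open>w i + phi > 0\<close> and to \<open>w i - phi ^ 2 < - phi\<close>, both outside the hit
  interval.\<close>

lemma no_hit_gap_AA:
  assumes "A i" "A (Suc i)" "s i < t" "t < s i + fib (Suc (Suc (Suc i)))"
  shows "\<not> hit y i t"
proof
  assume "hit y i t"
  then obtain N u where u: "real t * phi + y - of_int N = u * (- phi) ^ i" "- phi < u" "u < 0"
    unfolding hit_def by blast
  have u3: "u < phi ^ 2" using u(3) by (meson less_trans phi_pos zero_less_power)
  obtain N' where N': "real (s i) * phi + y - of_int N' = w i * (- phi) ^ i"
    using entry_point by blast
  have "phi ^ 3 = 2 * phi - 1" by (rule phi_powers)
  then show False
    using hit_times_displacement[OF assms(3,4) N' u(1) range u(2) u3] digit_1[OF assms(1,2)] u range[of i]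
      phi_square
    by linarith
qed

lemma hit_after_gap:
  assumes "w i > - (phi ^ 3)"
  shows "hit y i (s i + fib (Suc (Suc i)))"
proof -
  obtain N' where N': "real (s i) * phi + y - of_int N' = w i * (- phi) ^ i"
    using entry_point by blast
  have "real (s i + fib (Suc (Suc i))) * phi + y - of_int (N' + int (fib (Suc i)))
      = real (s i) * phi + y - of_int N' + (real (fib (Suc (Suc i))) * phi - real (fib (Suc i)))"
    by (simp add: algebra_simps)
  also have "\<dots> = (w i - phi ^ 2) * (- phi) ^ i"
    unfolding N' fib_Suc_mult_phi by (simp add: algebra_simps power2_eq_square)
  finally show ?thesis unfolding hit_def using assms range[of i] phi_powers(1) phi_square
    by (intro exI[of _ "N' + int (fib (Suc i))"] exI[of _ "w i - phi ^ 2"]) auto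
qed

lemma hit_gap_AB: "A i \<Longrightarrow> \<not> A (Suc i) \<Longrightarrow> hit y i (s i + fib (Suc (Suc i)))"
  using hit_after_gap digit_0 by blast

lemma hit_B: "\<not> A i \<Longrightarrow> hit y i (s i + fib (Suc (Suc i)))"
  using hit_after_gap[of i] sign[of i] nonzero[of i] zero_less_power[OF phi_pos, of 3] by linarith

lemma no_hit_before_B:
  assumes "\<not> A i" "t < s i + fib (Suc (Suc i))"
  shows "\<not> hit y i t"
proof
  assume h: "hit y i t"
  then obtain N u where u: "real t * phi + y - of_int N = u * (- phi) ^ i" "- phi < u" "u < 0"
    unfolding hit_def by blast
  have u3: "u < phi ^ 2" using u(3) by (meson less_trans phi_pos zero_less_power)
  obtain N' where N': "real (s i) * phi + y - of_int N' = w i * (- phi) ^ i"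
    using entry_point by blast
  have w: "w i > 0" using assms sign nonzero by (meson linorder_neqE_linordered_idom)
  have "s i \<le> t" using h hit_imp_hit_outer no_outer_hit_before by (meson not_less)
  moreover have "t \<noteq> s i"
    using displacement_unique[OF u(1), of N' "w i"] N' u range[of i] u3 w by auto
  ultimately have t: "s i < t" by simp
  have t': "t < s i + fib (Suc (Suc (Suc i)))" using assms(2) by simp
  show False
    using hit_times_displacement[OF t t' N' u(1) range u(2) u3] assms(2) u w phi_pos by auto
qed

lemma entry_time_bound: "(A i \<longrightarrow> s i < fib (Suc (Suc i))) \<and> (\<not> A i \<longrightarrow> s i < fib (Suc i))"
proof (induction i)
  case (Suc i)
  show ?case
    using Suc after_not_A[of i] by (cases "A i"; cases "A (Suc i)") (auto simp: step_digit_def)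
qed simp

end

text \<open>The map inverts the recursion, using \<open>1 + phi = 1 / phi\<close>, with the digit
  read off from the point itself. Genericity keeps the iterates away from the cut points
  \<open>0\<close> and \<open>- (phi ^ 3)\<close>, so all inequalities stay strict.\<close>

lemma generic_renormalization:
  assumes "generic y"
  shows "\<exists>A w. renormalization y A w"
proof -
  define w where "w = rec_nat (y - of_int \<lfloor>y + phi\<rfloor>)
    (\<lambda>i u. - (1 + phi) * u - of_bool (u < - (phi ^ 3)))"
  have w0: "w 0 = y - of_int \<lfloor>y + phi\<rfloor>" by (simp add: w_def)
  have wS: "w (Suc i) = - (1 + phi) * w i - of_bool (w i < - (phi ^ 3))" for i
    by (simp add: w_def)
  have rec: "w i = - phi * (w (Suc i) + of_bool (w i < - (phi ^ 3)))" for i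
  proof -
    have "phi * (1 + phi) = 1" by (simp add: algebra_simps phi_square')
    then have "w i = (phi * (1 + phi)) * w i" by simp
    then show ?thesis unfolding wS by (simp add: algebra_simps)
  qed
  have pt: "\<exists>n::nat. \<exists>N::int. w i * (- phi) ^ i = real n * phi + y - of_int N" for i
  proof (induction i)
    case 0
    have "w 0 * (- phi) ^ 0 = real 0 * phi + y - of_int \<lfloor>y + phi\<rfloor>" using w0 by simp
    then show ?case by blast
  next
    case (Suc i)
    then obtain n :: nat and N :: int where nN: "w i * (- phi) ^ i = real n * phi + y - of_int N"
      by blast
    define b where "b = (of_bool (w i < - (phi ^ 3)) :: nat)"
    have "w (Suc i) * (- phi) ^ Suc i = (- phi * w (Suc i)) * (- phi) ^ i" by simp
    also have "- phi * w (Suc i) = w i + phi * real b"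
      using rec[of i] by (simp add: b_def algebra_simps)
    also have "(w i + phi * real b) * (- phi) ^ i
        = w i * (- phi) ^ i + real b * (real (fib (Suc i)) * phi - real (fib i))"
      unfolding fib_Suc_mult_phi by (simp add: algebra_simps)
    also have "\<dots> = real (n + b * fib (Suc i)) * phi + y - of_int (N + int (b * fib i))"
      unfolding nN by (simp add: algebra_simps)
    finally show ?case by blast
  qed
  have nz: "w i \<noteq> 0" and ncube: "w i \<noteq> - (phi ^ 3)" for i
  proof -
    obtain n :: nat and N :: int where nN: "w i * (- phi) ^ i = real n * phi + y - of_int N"
      using pt by blast
    show "w i \<noteq> 0" using nN genericD[OF assms, of n N] by auto
    \<comment> \<open>At level \<open>i\<close> this cut point reaches an integer after
      \<open>fib (Suc (Suc (Suc i)))\<close> further steps.\<close>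
    show "w i \<noteq> - (phi ^ 3)"
    proof
      assume "w i = - (phi ^ 3)"
      then have "w i * (- phi) ^ i = - (phi * (- phi) ^ (Suc (Suc i)))"
        by (simp add: power3_eq_cube)
      also have "\<dots> = real (fib (Suc (Suc i))) - real (fib (Suc (Suc (Suc i)))) * phi"
        unfolding fib_Suc_mult_phi[symmetric] by simp
      finally have "real (n + fib (Suc (Suc (Suc i)))) * phi + y
          = of_int (N + int (fib (Suc (Suc i))))"
        using nN by (simp add: algebra_simps)
      then show False using genericD[OF assms] by blast
    qed
  qed
  have range: "- phi < w i \<and> w i < phi ^ 2" for i
  proof (induction i)
    case 0
    have "y + phi \<noteq> of_int \<lfloor>y + phi\<rfloor>" using genericD[OF assms, of 1] by (simp add: add.commute)
    then have "- phi < w 0" using w0 by linarith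
    moreover have "w 0 < phi ^ 2" unfolding w0 phi_square by linarith
    ultimately show ?case by simp
  next
    case (Suc i)
    show ?case
    proof (cases "w i < - (phi ^ 3)")
      case True
      then have r: "- phi * w (Suc i) = w i + phi" using rec[of i] by (simp add: algebra_simps)
      have "phi * 0 < phi * (- w (Suc i))" using r Suc by simp
      moreover have "phi * (- w (Suc i)) < phi * phi"
        using r phi_square' True phi_powers(1) by simp
      ultimately have "0 < - w (Suc i)" "- w (Suc i) < phi"
        unfolding mult_less_cancel_left_pos[OF phi_pos] by blast+
      then show ?thesis using zero_less_power[OF phi_pos, of 2] by linarith
    next
      case False
      then have r: "- phi * w (Suc i) = w i" using rec[of i] by (simp add: algebra_simps)
      have "phi * (- w (Suc i)) < phi * phi" using r Suc phi_square phi_square' by simp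
      moreover have "phi * (- (phi ^ 2)) < phi * (- w (Suc i))"
        using False ncube[of i] r by (simp add: power2_eq_square power3_eq_cube mult.assoc)
      ultimately have "- w (Suc i) < phi" "- (phi ^ 2) < - w (Suc i)"
        unfolding mult_less_cancel_left_pos[OF phi_pos] by blast+
      then show ?thesis by linarith
    qed
  qed
  have dig: "w i < - (phi ^ 3) \<longleftrightarrow> w i < 0 \<and> w (Suc i) < 0" for i
  proof (cases "w i < - (phi ^ 3)")
    case True
    then have "- phi * w (Suc i) = w i + phi" using rec[of i] by (simp add: algebra_simps)
    then have "0 < phi * (- w (Suc i))" using range[of i] by simp
    then have "0 < - w (Suc i)" by (rule zero_less_mult_pos) simp
    then have "w (Suc i) < 0" by simp
    then show ?thesis using True zero_less_power[OF phi_pos, of 3] by linarith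
  next
    case False
    then have "- phi * w (Suc i) = w i" using rec[of i] by (simp add: algebra_simps)
    then have "w i < 0 \<Longrightarrow> 0 < phi * w (Suc i)" by simp
    then have "w i < 0 \<Longrightarrow> w (Suc i) > 0" by (metis zero_less_mult_pos phi_pos)
    then show ?thesis using False by fastforce
  qed
  have "renormalization y (\<lambda>i. w i < 0) w"
  proof
    show "\<exists>N::int. y - of_int N = w 0" using w0 by auto
    show "w i = - phi * (w (Suc i) + real (step_digit (\<lambda>i. w i < 0) i))" for i
      using rec[of i] dig[of i] by (simp add: step_digit_def)
  qed (use range nz in auto)
  then show ?thesis by blast
qed

lemma hit_within:
  assumes "generic y"
  shows "\<exists>t < fib (Suc (Suc (Suc i))). hit y i t"
proof -
  obtain A w where "renormalization y A w" using generic_renormalization[OF assms] by blast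
  then interpret renormalization y A w .
  show ?thesis
  proof (cases "A i")
    case True
    then show ?thesis using hit_entry[of i] entry_time_bound[of i]
      by (intro exI[of _ "s i"]) auto
  next
    case False
    then show ?thesis using hit_B[of i] entry_time_bound[of i]
      by (intro exI[of _ "s i + fib (Suc (Suc i))"]) auto
  qed
qed

subsection \<open>Repetitions in words over a generic point\<close>

definition word :: "real \<Rightarrow> nat \<Rightarrow> int" where
  "word y t = \<lfloor>real (Suc t) * phi + y\<rfloor> - \<lfloor>real t * phi + y\<rfloor>"

text \<open>\<open>k\<close> counts the letters before the later occurrence, so that
  \<open>rep_fun n x\<close> is \<open>n\<close> plus the least such \<open>k\<close>.\<close>

definition recurs :: "(nat \<Rightarrow> 'a) \<Rightarrow> nat \<Rightarrow> nat \<Rightarrow> bool" where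
  "recurs x k n \<longleftrightarrow> (\<exists>j<k. \<forall>i<n. x (j + i) = x (k + i))"

lemma factor_Suc: "factor x (Suc j) (j + n) = map (\<lambda>i. x (j + i)) [0..<n]"
  unfolding factor_def by (rule nth_equalityI) (auto simp del: upt_Suc)

lemma rep_fun_candidate:
  "(\<exists>j. 1 \<le> j \<and> j \<le> m - n \<and> factor x j (j + n - 1) = factor x (m - n + 1) m)
    \<longleftrightarrow> n \<le> m \<and> recurs x (m - n) n" (is "?L \<longleftrightarrow> ?R")
proof
  assume ?L
  then obtain j where j: "1 \<le> j" "j \<le> m - n" "factor x j (j + n - 1) = factor x (m - n + 1) m"
    by blast
  obtain j' where j': "j = Suc j'" using j(1) by (cases j) auto
  have m: "m = m - n + n" using j by simp
  have "factor x (Suc j') (j' + n) = factor x (Suc (m - n)) (m - n + n)"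
    using j(3) m j' by simp
  then have "\<forall>i<n. x (j' + i) = x ((m - n) + i)"
    unfolding factor_Suc by (simp add: list_eq_iff_nth_eq del: Nat.add_diff_assoc2)
  moreover have "j' < m - n" "n \<le> m" using j(2) j' m by linarith+
  ultimately show ?R unfolding recurs_def by blast
next
  assume R: ?R
  then obtain j where j: "j < m - n" "\<forall>i<n. x (j + i) = x (m - n + i)" unfolding recurs_def by blast
  have "factor x (Suc j) (j + n) = factor x (Suc (m - n)) (m - n + n)"
    unfolding factor_Suc using j by simp
  then show ?L using j R by (intro exI[of _ "Suc j"]) auto
qed

lemma rep_fun_le: "recurs x k n \<Longrightarrow> rep_fun n x \<le> n + k"
  unfolding rep_fun_def rep_fun_candidate by (rule Least_le) simp

lemma rep_fun_attained:
  assumes "recurs x k n"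
  obtains k' where "rep_fun n x = n + k'" "recurs x k' n"
proof -
  define m where "m = (LEAST m. n \<le> m \<and> recurs x (m - n) n)"
  have "n \<le> m \<and> recurs x (m - n) n" unfolding m_def
    by (rule LeastI[of _ "n + k"]) (use assms in simp)
  then show ?thesis using that[of "m - n"] unfolding rep_fun_def rep_fun_candidate m_def by auto
qed

lemma recurs_exists:
  assumes "finite (range x)"
  shows "\<exists>k. recurs x k n"
proof -
  define f where "f k = map (\<lambda>i. x (k + i)) [0..<n]" for k
  have "range f \<subseteq> {xs. set xs \<subseteq> range x \<and> length xs = n}" by (auto simp: f_def)
  moreover have "finite {xs. set xs \<subseteq> range x \<and> length xs = n}"
    using assms by (rule finite_lists_length_eq)
  ultimately have "finite (range f)" by (rule finite_subset)
  then have "\<not> inj f" using finite_imageD by (metis infinite_UNIV_nat)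
  then obtain j k where "f j = f k" "j < k" unfolding inj_def by (metis linorder_neqE_nat)
  then have "recurs x k n" unfolding recurs_def f_def by (auto simp: list_eq_iff_nth_eq)
  then show ?thesis by blast
qed

section \<open>Matching windows as floors that a rotation leaves unchanged\<close>

lemma word_range: "word y t \<in> {0, 1}"
proof -
  have Suc: "real (Suc t) * phi + y = (real t * phi + y) + phi" by (simp add: algebra_simps)
  have "\<lfloor>z + phi\<rfloor> - \<lfloor>z\<rfloor> = 0 \<or> \<lfloor>z + phi\<rfloor> - \<lfloor>z\<rfloor> = 1" for z
    using phi_pos phi_less_1 by linarith
  then show ?thesis unfolding word_def Suc by blast
qed

text \<open>Letters are increments of floors, so windows agree when the difference of floors is
  constant. A window of \<open>n\<close> letters sees \<open>n + 1\<close> orbit points, hence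
  \<open>i<n\<close> on the left and \<open>i\<le>n\<close> on the right.\<close>

lemma word_match_iff:
  "(\<forall>i<n. word y (j + i) = word y (k + i)) \<longleftrightarrow>
   (\<forall>i\<le>n. \<lfloor>real (k + i) * phi + y\<rfloor> - \<lfloor>real (j + i) * phi + y\<rfloor>
        = \<lfloor>real k * phi + y\<rfloor> - \<lfloor>real j * phi + y\<rfloor>)"
proof -
  define G where "G i = \<lfloor>real (k + i) * phi + y\<rfloor> - \<lfloor>real (j + i) * phi + y\<rfloor>" for i
  have step: "word y (j + i) = word y (k + i) \<longleftrightarrow> G (Suc i) = G i" for i
    unfolding word_def G_def add_Suc_right by linarith
  have "(\<forall>i<n. G (Suc i) = G i) \<longleftrightarrow> (\<forall>i\<le>n. G i = G 0)"
  proof (induction n)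
    case (Suc n)
    have "(\<forall>i<Suc n. G (Suc i) = G i) \<longleftrightarrow> (\<forall>i\<le>n. G i = G 0) \<and> G (Suc n) = G n"
      unfolding Suc.IH[symmetric] less_Suc_eq by blast
    also have "\<dots> \<longleftrightarrow> (\<forall>i\<le>Suc n. G i = G 0)" unfolding le_Suc_eq by (metis le_refl)
    finally show ?case .
  qed simp
  then show ?thesis unfolding step by (simp add: G_def)
qed

lemma word_match_shift:
  assumes "\<forall>i<n. word y (j + i) = word y (j + p + i)"
  obtains q :: int where
    "\<And>t. j \<le> t \<Longrightarrow> t \<le> j + n \<Longrightarrow> \<lfloor>real t * phi + y + (real p * phi - of_int q)\<rfloor> = \<lfloor>real t * phi + y\<rfloor>"
proof
  define q where "q = \<lfloor>real (j + p) * phi + y\<rfloor> - \<lfloor>real j * phi + y\<rfloor>"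
  fix t assume t: "j \<le> t" "t \<le> j + n"
  then obtain i where i: "t = j + i" "i \<le> n" using le_Suc_ex by auto
  have "\<lfloor>real (j + p + i) * phi + y\<rfloor> - \<lfloor>real (j + i) * phi + y\<rfloor> = q"
    using assms i(2) unfolding word_match_iff q_def by blast
  moreover have "real t * phi + y + (real p * phi - of_int q) = real (j + p + i) * phi + y - of_int q"
    using i by (simp add: algebra_simps)
  ultimately show "\<lfloor>real t * phi + y + (real p * phi - of_int q)\<rfloor> = \<lfloor>real t * phi + y\<rfloor>"
    using i(1) by (simp only: floor_diff_of_int)
qed

lemma floor_neq_if_separated:
  fixes z z' :: real
  assumes "(z - of_int N) * (z' - of_int N) < 0"
  shows "\<lfloor>z\<rfloor> \<noteq> \<lfloor>z'\<rfloor>"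
proof -
  consider "z < of_int N" "of_int N \<le> z'" | "z' < of_int N" "of_int N \<le> z"
    using assms unfolding mult_less_0_iff by linarith
  then show ?thesis
    by cases (metis floor_less_iff le_floor_iff not_less)+
qed

lemma separated_if_floor_neq:
  fixes z z' :: real
  assumes "\<lfloor>z\<rfloor> \<noteq> \<lfloor>z'\<rfloor>" "\<And>N. z \<noteq> of_int N" "\<And>N. z' \<noteq> of_int N"
  shows "\<exists>N::int. (z - of_int N) * (z' - of_int N) < 0"
proof (cases "\<lfloor>z\<rfloor> < \<lfloor>z'\<rfloor>")
  case True
  then have "z - of_int \<lfloor>z'\<rfloor> < 0" "z' - of_int \<lfloor>z'\<rfloor> > 0"
    using assms(3)[of "\<lfloor>z'\<rfloor>"] by linarith+
  then show ?thesis using mult_neg_pos by blast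
next
  case False
  then have "z - of_int \<lfloor>z\<rfloor> > 0" "z' - of_int \<lfloor>z\<rfloor> < 0"
    using assms(1) assms(2)[of "\<lfloor>z\<rfloor>"] by linarith+
  then show ?thesis using mult_pos_neg by blast
qed

text \<open>The factor \<open>c\<close> admits every displacement in the direction of the one for
  \<open>fib (Suc i)\<close> that is at least as long: it carries a hit across the same integer.
  This excludes periods that are not Fibonacci numbers.\<close>

lemma hit_floor_neq:
  assumes "hit y i t" "c \<ge> 1"
  shows "\<lfloor>real t * phi + y + phi * (- phi) ^ i * c\<rfloor> \<noteq> \<lfloor>real t * phi + y\<rfloor>"
proof
  obtain N :: int and u where N: "real t * phi + y - of_int N = u * (- phi) ^ i" and u: "- phi < u" "u < 0"
    using assms(1) unfolding hit_def by blast
  let ?z = "real t * phi + y" and ?z' = "real t * phi + y + phi * (- phi) ^ i * c"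
  assume eq: "\<lfloor>?z'\<rfloor> = \<lfloor>?z\<rfloor>"
  have N': "?z' - of_int N = (u + phi * c) * (- phi) ^ i" using N by (simp add: algebra_simps)
  have "phi * 1 \<le> phi * c" using assms(2) by (intro mult_left_mono) auto
  then have "u + phi * c > 0" using u by linarith
  then have "u * (u + phi * c) < 0" by (rule mult_neg_pos[OF u(2)])
  then have "(u * (u + phi * c)) * ((- phi) ^ i) ^ 2 < 0" by (rule mult_neg_pos) simp
  then have "(?z - of_int N) * (?z' - of_int N) < 0"
    unfolding N N' by (simp add: power2_eq_square mult_ac)
  then show False using floor_neq_if_separated eq by metis
qed

text \<open>Different floors mean that an integer separates the point from its image; in the scaled
  coordinate \<open>u\<close> and \<open>u + phi\<close> then have opposite signs, which is a hit.
  Genericity keeps both points off the integers.\<close>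

lemma no_hit_floor_eq:
  assumes "generic y" "\<not> hit y i t"
  shows "\<lfloor>real t * phi + y + phi * (- phi) ^ i\<rfloor> = \<lfloor>real t * phi + y\<rfloor>"
proof (rule ccontr)
  let ?z = "real t * phi + y" and ?z' = "real t * phi + y + phi * (- phi) ^ i"
  assume neq: "\<lfloor>?z'\<rfloor> \<noteq> \<lfloor>?z\<rfloor>"
  have z: "?z \<noteq> of_int N" for N using genericD[OF assms(1)] .
  have z': "?z' \<noteq> of_int N" for N
  proof -
    have "?z' = real (t + fib (Suc i)) * phi + y - of_int (int (fib i))"
      unfolding fib_Suc_mult_phi[symmetric] by (simp add: algebra_simps)
    then show ?thesis using genericD[OF assms(1), of "t + fib (Suc i)" "N + int (fib i)"] by simp
  qed
  have "\<exists>N::int. (?z - of_int N) * (?z' - of_int N) < 0"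
    using separated_if_floor_neq[OF neq[symmetric]] z z' by blast
  then obtain N :: int where N: "(?z - of_int N) * (?z' - of_int N) < 0" by blast
  define u where "u = (?z - of_int N) / (- phi) ^ i"
  have zu: "?z - of_int N = u * (- phi) ^ i" by (simp add: u_def)
  then have zu': "?z' - of_int N = (u + phi) * (- phi) ^ i" by (simp add: algebra_simps)
  have "(u * (u + phi)) * ((- phi) ^ i) ^ 2 < 0"
    using N unfolding zu zu' by (simp add: power2_eq_square mult_ac)
  then have "u * (u + phi) < 0" by (metis mult_less_0_iff not_less zero_le_power2)
  then have "- phi < u" "u < 0" using phi_pos unfolding mult_less_0_iff by linarith+
  then show False using assms(2) zu unfolding hit_def by blast
qed

lemma recurs_if_no_hit:
  assumes "generic y" and no: "\<And>t. j \<le> t \<Longrightarrow> t \<le> j + n \<Longrightarrow> \<not> hit y m t"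
  shows "recurs (word y) (j + fib (Suc m)) n"
proof -
  have eq: "\<lfloor>real (j + fib (Suc m) + i) * phi + y\<rfloor> - \<lfloor>real (j + i) * phi + y\<rfloor> = int (fib m)"
    if "i \<le> n" for i
  proof -
    have "real (j + fib (Suc m) + i) * phi + y = real (j + i) * phi + y + phi * (- phi) ^ m + of_int (int (fib m))"
      unfolding fib_Suc_mult_phi[symmetric] by (simp add: algebra_simps)
    then have "\<lfloor>real (j + fib (Suc m) + i) * phi + y\<rfloor>
        = \<lfloor>real (j + i) * phi + y + phi * (- phi) ^ m\<rfloor> + int (fib m)"
      by (simp only: floor_add_int[symmetric])
    then show ?thesis using no_hit_floor_eq[OF assms(1) no, of "j + i"] that by simp
  qed
  have "\<forall>i<n. word y (j + i) = word y (j + fib (Suc m) + i)"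
    unfolding word_match_iff using eq eq[of 0] by simp
  then show ?thesis unfolding recurs_def by (intro exI[of _ j]) simp
qed

lemma hit_in_window:
  assumes "generic y" "fib (Suc (Suc (Suc i))) \<le> n"
  shows "\<exists>t. j \<le> t \<and> t \<le> j + n \<and> hit y i t"
proof -
  obtain t where "t < fib (Suc (Suc (Suc i)))" "hit (real j * phi + y) i t"
    using hit_within[OF generic_shift[OF assms(1)]] by blast
  then show ?thesis using assms(2) by (intro exI[of _ "j + t"]) (auto simp: hit_shift)
qed

text \<open>The window is long enough to contain a hit of every level up to \<open>Suc i\<close>, so
  the displacement of \<open>p\<close> cannot exceed that of any such level in its direction. In the
  lattice basis this leaves only the vector with \<open>a = 0\<close> and
  \<open>b = 1\<close>.\<close>

lemma short_period_is_fib: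
  assumes y: "generic y" and p: "0 < p" "p < fib (Suc (Suc (Suc (Suc i))))"
    and n: "fib (Suc (Suc (Suc (Suc i)))) \<le> n"
    and match: "\<forall>i<n. word y (j + i) = word y (j + p + i)"
  shows "p = fib (Suc (Suc (Suc i))) \<and> (\<forall>t. j \<le> t \<and> t \<le> j + n \<longrightarrow> \<not> hit y (Suc (Suc i)) t)"
proof -
  obtain q :: int where q: "\<And>t. j \<le> t \<Longrightarrow> t \<le> j + n \<Longrightarrow>
      \<lfloor>real t * phi + y + (real p * phi - of_int q)\<rfloor> = \<lfloor>real t * phi + y\<rfloor>"
    using word_match_shift[OF match] by blast
  obtain a b :: int where pab: "int p = a * int (fib (Suc (Suc i))) + b * int (fib (Suc (Suc (Suc i))))"
    and e: "of_int (int p) * phi - of_int q = phi * (- phi) ^ Suc i * (of_int a - phi * of_int b)"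
    using lattice_basis by blast
  have f: "int (fib (Suc (Suc i))) > 0" "int (fib (Suc (Suc (Suc i)))) > 0"
    by (simp_all only: of_nat_0_less_iff fib_Suc_pos)
  have f': "int (fib (Suc (Suc (Suc (Suc i))))) = int (fib (Suc (Suc (Suc i)))) + int (fib (Suc (Suc i)))"
    "int (fib (Suc (Suc i))) \<le> int (fib (Suc (Suc (Suc i))))"
    by auto
  note f = f f'
  have not_large: False if "real p * phi - of_int q = phi * (- phi) ^ m * c" "c \<ge> 1" "m \<le> Suc i" for m c
  proof -
    have "fib (Suc (Suc (Suc m))) \<le> fib (Suc (Suc (Suc (Suc i))))"
      using that(3) by (intro fib_mono) simp
    then obtain t where "j \<le> t" "t \<le> j + n" "hit y m t"
      using hit_in_window[OF y, of m n j] n by (metis le_trans)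
    then show False using q[of t] hit_floor_neq[of y m t c] that by simp
  qed
  consider "a \<ge> 1" "b \<ge> 1" | "a \<le> 0" "b \<le> 0" | "a \<ge> 1" "b \<le> 0"
    | "a \<le> -1" "b \<ge> 1" | "a = 0" "b \<ge> 1" by linarith
  then show ?thesis
  proof cases
    case 1
    have "int p \<ge> 1 * int (fib (Suc (Suc i))) + 1 * int (fib (Suc (Suc (Suc i))))"
      unfolding pab using 1 f by (intro add_mono mult_right_mono) auto
    then show ?thesis using p f by linarith
  next
    case 2
    have "int p \<le> 0"
      unfolding pab using 2 f by (intro add_nonpos_nonpos mult_nonpos_nonneg) auto
    then show ?thesis using p by simp
  next
    case 3
    have "phi * of_int b \<le> 0" using 3 by (intro mult_nonneg_nonpos) auto
    moreover have "(of_int a :: real) \<ge> 1" using 3 by simp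
    ultimately have "of_int a - phi * of_int b \<ge> 1" by linarith
    then show ?thesis using not_large[of "Suc i"] e by simp
  next
    case 4
    \<comment> \<open>The displacement now points the other way, so it is measured at level
      \<open>i\<close>, whose direction is opposite to that of \<open>Suc i\<close>; the factor is
      at least \<open>phi + phi ^ 2 = 1\<close>.\<close>
    have "phi * 1 \<le> phi * (- of_int a)" "phi ^ 2 * 1 \<le> phi ^ 2 * of_int b"
      using 4 by (intro mult_left_mono; simp)+
    moreover have "phi * (phi * of_int b - of_int a) = phi ^ 2 * of_int b + phi * (- of_int a)"
      by (simp add: algebra_simps power2_eq_square)
    ultimately have "phi * (phi * of_int b - of_int a) \<ge> 1"
      using phi_square by linarith
    moreover have "real p * phi - of_int q = phi * (- phi) ^ i * (phi * (phi * of_int b - of_int a))"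
      using e by (simp add: algebra_simps)
    ultimately show ?thesis using not_large[of i] by simp
  next
    case 5
    have "b = 1"
    proof (rule ccontr)
      assume "b \<noteq> 1"
      then have "b \<ge> 2" using 5 by simp
      then have "b * int (fib (Suc (Suc (Suc i)))) \<ge> 2 * int (fib (Suc (Suc (Suc i))))"
        by (rule mult_right_mono) simp
      then show False using p pab 5 f by simp
    qed
    then have "int p = int (fib (Suc (Suc (Suc i))))" using 5 pab by simp
    then have pe: "p = fib (Suc (Suc (Suc i)))" by (simp only: of_nat_eq_iff)
    have "real p * phi - of_int q = phi * (- phi) ^ Suc i * (0 - phi * 1)"
      using e \<open>b = 1\<close> 5 by simp
    then have ee: "real p * phi - of_int q = phi * (- phi) ^ Suc (Suc i) * 1"
      by (simp add: mult_ac)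
    show ?thesis
    proof (intro conjI allI impI)
      fix t assume t: "j \<le> t \<and> t \<le> j + n"
      show "\<not> hit y (Suc (Suc i)) t"
        using hit_floor_neq[of y "Suc (Suc i)" t 1] q[of t] t ee by auto
    qed (rule pe)
  qed
qed

locale generic_renormalization = renormalization +
  assumes generic: "generic y"
begin

text \<open>The \<open>n + 1\<close> orbit points of the window are exactly the times strictly
  between \<open>s i\<close> and \<open>s i + fib (Suc (Suc (Suc i)))\<close>, which accounts for
  the subtraction of 2.\<close>

lemma recurs_AA:
  assumes "A i" "A (Suc i)"
  shows "recurs (word y) (s i + 1 + fib (Suc i)) (fib (Suc (Suc (Suc i))) - 2)"
proof (rule recurs_if_no_hit[OF generic])
  fix t assume t: "s i + 1 \<le> t" "t \<le> s i + 1 + (fib (Suc (Suc (Suc i))) - 2)"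
  have "fib (Suc (Suc (Suc i))) \<ge> 2" using fib_Suc_pos[of i] unfolding fib2 by linarith
  then show "\<not> hit y i t" using no_hit_gap_AA[OF assms, of t] t by linarith
qed

text \<open>Here the window starts at the origin and ends just before the first hit of level
  \<open>i\<close>.\<close>

lemma recurs_B:
  assumes "\<not> A i"
  shows "recurs (word y) (fib (Suc i)) (s i + fib (Suc (Suc i)) - 1)"
proof -
  have "recurs (word y) (0 + fib (Suc i)) (s i + fib (Suc (Suc i)) - 1)"
  proof (rule recurs_if_no_hit[OF generic])
    fix t assume t: "0 \<le> t" "t \<le> 0 + (s i + fib (Suc (Suc i)) - 1)"
    have "fib (Suc (Suc i)) \<ge> 1" using fib_Suc_pos[of "Suc i"] by linarith
    then show "\<not> hit y i t" using no_hit_before_B[OF assms, of t] t by linarith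
  qed
  then show ?thesis by simp
qed

text \<open>A period below \<open>fib (Suc (Suc m))\<close> must be \<open>fib (Suc m)\<close>, with
  a window free of hits of level \<open>m\<close>. The window must then start after every hit at a
  time up to \<open>n\<close>, and the known first hits push \<open>j\<close>, hence
  \<open>k\<close>, far enough to the right.\<close>

lemma recurs_lower_bound:
  assumes rec: "recurs (word y) k n" and n: "fib (Suc (Suc m)) \<le> n" and m: "m \<ge> 2"
  shows "fib (Suc (Suc m)) \<le> k \<or> A m \<and> A (Suc m) \<and> s m + fib (Suc m) \<le> k
    \<or> \<not> A m \<and> n < s m + fib (Suc (Suc m)) \<and> fib (Suc m) \<le> k"
proof (rule ccontr)
  assume neg: "\<not> ?thesis"
  obtain j where j: "j < k" and eq: "\<forall>i<n. word y (j + i) = word y (k + i)"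
    using rec unfolding recurs_def by blast
  obtain i where i: "m = Suc (Suc i)" using m by (metis add_2_eq_Suc le_Suc_ex)
  define p where "p = k - j"
  have p: "0 < p" "p < fib (Suc (Suc m))" and k: "k = j + p"
    using j neg by (auto simp: p_def)
  have pm: "p = fib (Suc m)" and no: "\<And>t. j \<le> t \<Longrightarrow> t \<le> j + n \<Longrightarrow> \<not> hit y m t"
    using short_period_is_fib[OF generic p(1) _ _ eq[unfolded k]] p(2) n unfolding i by blast+
  have after: "h < j" if "hit y m h" "h \<le> n" for h
    using no[of h] that by force
  show False
  proof (cases "A m")
    case True
    then have "s m < j" using after[OF hit_entry] entry_time_bound[of m] n by simp
    then have AB: "\<not> A (Suc m)" using neg k pm True by auto
    show False
    proof (cases "j \<le> s m + fib (Suc (Suc m))")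
      case True
      then show False using no[OF True] hit_gap_AB[OF \<open>A m\<close> AB] \<open>s m < j\<close> n by simp
    next
      case False
      then show False using neg k by auto
    qed
  next
    case False
    show False
    proof (cases "n < s m + fib (Suc (Suc m))")
      case True
      then show False using neg False k pm by auto
    next
      case F: False
      then have "s m + fib (Suc (Suc m)) < j" using after[OF hit_B[OF False]] by simp
      then show False using neg k by auto
    qed
  qed
qed

end

subsection \<open>The exponent of repetition in terms of itineraries\<close>

text \<open>The recursion of \<open>entry_time A i / fib (Suc i)\<close>, with the quotient of
  consecutive Fibonacci numbers replaced by its limit \<open>phi\<close>.\<close>

primrec weight :: "(nat \<Rightarrow> bool) \<Rightarrow> nat \<Rightarrow> real" where
  "weight A 0 = 0"
| "weight A (Suc i) = phi * (weight A i + real (step_digit A i))"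

lemma weight_nonneg: "weight A i \<ge> 0"
  by (induction i) auto

lemma weight_le: "weight A i \<le> 1 + phi"
proof (induction i)
  case (Suc i)
  have "real (step_digit A i) \<le> 1" by (simp add: step_digit_def)
  then have "weight A (Suc i) \<le> phi * (1 + phi + 1)"
    using Suc unfolding weight.simps by (intro mult_left_mono) auto
  then show ?case using phi_square' by (simp add: algebra_simps)
qed simp

text \<open>The digit just before a \<open>B\<close> is 0, so the last step only multiplies the
  general bound \<open>1 + phi\<close> by \<open>phi\<close>.\<close>

lemma weight_le_1:
  assumes "\<not> A i"
  shows "weight A i \<le> 1"
proof (cases i)
  case (Suc k)
  then have "weight A i = phi * weight A k" using assms by (simp add: step_digit_def)
  also have "\<dots> \<le> phi * (1 + phi)" using weight_le by (intro mult_left_mono) auto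
  finally show ?thesis using phi_square' by (simp add: algebra_simps)
qed simp

text \<open>Binet's formula multiplied by \<open>phi ^ i\<close>; the denominator
  \<open>1 + 2 * phi\<close> is the square root of 5.\<close>

lemma fib_times_power_phi:
  "real (fib (Suc i)) * phi ^ i = (1 + phi) / (1 + 2 * phi) + phi / (1 + 2 * phi) * (- (phi ^ 2)) ^ i"
proof (induction i rule: fib.induct)
  case 1
  have "1 + 2 * phi > 0" using phi_pos by linarith
  then show ?case by (simp flip: add_divide_distrib)
next
  case 2
  have "phi * (1 + 2 * phi) = (1 + phi) - phi * phi ^ 2"
    using phi_square' by (simp add: phi_square algebra_simps)
  moreover have "1 + 2 * phi > 0" using phi_pos by linarith
  ultimately have "phi = ((1 + phi) - phi * phi ^ 2) / (1 + 2 * phi)" by (metis less_irrefl nonzero_eq_divide_eq)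
  then show ?case by (simp add: diff_divide_distrib)
next
  case (3 i)
  define C where "C = (1 + phi) / (1 + 2 * phi)"
  define C' where "C' = phi / (1 + 2 * phi)"
  define x where "x = - (phi ^ 2)"
  have x: "x ^ 2 = phi * x + phi ^ 2"
    unfolding x_def phi_square by (simp add: power2_eq_square algebra_simps phi_square')
  have "real (fib (Suc (Suc (Suc i)))) * phi ^ Suc (Suc i)
      = phi * (real (fib (Suc (Suc i))) * phi ^ Suc i) + phi ^ 2 * (real (fib (Suc i)) * phi ^ i)"
    by (simp add: algebra_simps power2_eq_square)
  also have "\<dots> = phi * (C + C' * x ^ Suc i) + phi ^ 2 * (C + C' * x ^ i)"
    using 3 by (simp only: C_def C'_def x_def)
  also have "\<dots> = (phi + phi ^ 2) * C + C' * x ^ i * (phi * x + phi ^ 2)"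
    by (simp add: algebra_simps)
  also have "phi + phi ^ 2 = 1" by (simp add: phi_square)
  also have "1 * C + C' * x ^ i * (phi * x + phi ^ 2) = C + C' * x ^ Suc (Suc i)"
    unfolding x[symmetric] by (simp add: power2_eq_square)
  finally show ?case by (simp only: C_def C'_def x_def)
qed

lemma fib_times_power_phi_error:
  "\<bar>real (fib (Suc i)) * phi ^ i - (1 + phi) / (1 + 2 * phi)\<bar> \<le> phi ^ i"
proof -
  have "\<bar>real (fib (Suc i)) * phi ^ i - (1 + phi) / (1 + 2 * phi)\<bar> = phi / (1 + 2 * phi) * (phi ^ 2) ^ i"
    unfolding fib_times_power_phi by (simp add: abs_mult power_abs)
  also have "\<dots> \<le> 1 * phi ^ i"
  proof (intro mult_mono power_mono)
    show "phi ^ 2 \<le> phi" by (simp add: power2_eq_square)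
    show "phi / (1 + 2 * phi) \<le> 1" using phi_pos by (simp add: pos_divide_le_eq add_pos_pos)
  qed auto
  finally show ?thesis by simp
qed

text \<open>Each of the \<open>i\<close> steps introduces an error which, after the later
  multiplications by \<open>phi\<close>, is at most \<open>phi ^ i\<close>.\<close>

lemma entry_time_error:
  "\<bar>real (entry_time A i) * phi ^ i - (1 + phi) / (1 + 2 * phi) * weight A i\<bar> \<le> real i * phi ^ i"
proof (induction i)
  case (Suc i)
  define C where "C = (1 + phi) / (1 + 2 * phi)"
  have "\<bar>real (entry_time A (Suc i)) * phi ^ Suc i - C * weight A (Suc i)\<bar>
      = \<bar>phi * ((real (entry_time A i) * phi ^ i - C * weight A i)
          + real (step_digit A i) * (real (fib (Suc i)) * phi ^ i - C))\<bar>"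
    by (simp add: algebra_simps)
  also have "\<dots> = phi * \<bar>(real (entry_time A i) * phi ^ i - C * weight A i)
          + real (step_digit A i) * (real (fib (Suc i)) * phi ^ i - C)\<bar>"
    by (simp add: abs_mult)
  also have "\<dots> \<le> phi * (real i * phi ^ i + 1 * phi ^ i)"
  proof (intro mult_left_mono order_trans[OF abs_triangle_ineq] add_mono)
    show "\<bar>real (step_digit A i) * (real (fib (Suc i)) * phi ^ i - C)\<bar> \<le> 1 * phi ^ i"
      unfolding abs_mult using fib_times_power_phi_error[of i]
      by (intro mult_mono) (auto simp: C_def step_digit_def)
  qed (use Suc in \<open>auto simp: C_def\<close>)
  finally show ?case by (simp add: C_def algebra_simps)
qed simp

section \<open>Limits of the scaled entry times\<close>

lemma phi_power_tendsto: "(\<lambda>i. phi ^ i) \<longlonglongrightarrow> 0"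
  by (rule LIMSEQ_power_zero) simp

lemma phi_power_times_n_tendsto: "(\<lambda>i. real i * phi ^ i) \<longlonglongrightarrow> 0"
  by (rule powser_times_n_limit_0) simp

lemma fib_times_power_phi_tendsto:
  "(\<lambda>i. real (fib (Suc i)) * phi ^ i) \<longlonglongrightarrow> (1 + phi) / (1 + 2 * phi)"
proof (rule Lim_transform2[OF tendsto_const])
  show "(\<lambda>i. (1 + phi) / (1 + 2 * phi) - real (fib (Suc i)) * phi ^ i) \<longlonglongrightarrow> 0"
    by (rule Lim_null_comparison[OF _ phi_power_tendsto])
      (use fib_times_power_phi_error in \<open>simp add: abs_minus_commute\<close>)
qed

lemma limit_nonzero: "(1 + phi) / (1 + 2 * phi) \<noteq> 0"
  using phi_pos by (smt (verit) divide_eq_0_iff)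

lemma inverse_fib_tendsto: "(\<lambda>i. 1 / real (fib (Suc i))) \<longlonglongrightarrow> 0"
proof -
  have "(\<lambda>i. phi ^ i / (real (fib (Suc i)) * phi ^ i)) \<longlonglongrightarrow> 0 / ((1 + phi) / (1 + 2 * phi))"
    by (intro tendsto_divide phi_power_tendsto fib_times_power_phi_tendsto limit_nonzero)
  then show ?thesis by simp
qed

lemma fib_ratio_tendsto: "(\<lambda>i. real (fib (Suc (Suc i))) / real (fib (Suc i))) \<longlonglongrightarrow> 1 + phi"
proof -
  define C where "C = (1 + phi) / (1 + 2 * phi)"
  define G where "G i = real (fib (Suc i)) * phi ^ i" for i
  have C: "C \<noteq> 0" and G: "G \<longlonglongrightarrow> C"
    unfolding C_def G_def by (rule limit_nonzero, rule fib_times_power_phi_tendsto)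
  have "(\<lambda>i. inverse phi * (G (Suc i) / G i)) \<longlonglongrightarrow> inverse phi * (C / C)"
    by (intro tendsto_mult tendsto_divide tendsto_const LIMSEQ_Suc[OF G] G C)
  moreover have "inverse phi * (C / C) = 1 + phi" using C by (simp add: inverse_phi)
  moreover have "inverse phi * (G (Suc i) / G i) = real (fib (Suc (Suc i))) / real (fib (Suc i))" for i
    unfolding G_def by (simp add: field_simps del: fib2)
  ultimately show ?thesis by (simp only:)
qed

lemma entry_time_tendsto:
  "(\<lambda>i. real (entry_time A i) / real (fib (Suc i)) - weight A i) \<longlonglongrightarrow> 0"
proof -
  define C where "C = (1 + phi) / (1 + 2 * phi)"
  define G where "G i = real (fib (Suc i)) * phi ^ i" for i
  have "(\<lambda>i. (real (entry_time A i) * phi ^ i - C * weight A i) - weight A i * (G i - C)) \<longlonglongrightarrow> 0"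
  proof (rule Lim_null_comparison)
    show "\<forall>\<^sub>F i in sequentially.
      norm ((real (entry_time A i) * phi ^ i - C * weight A i) - weight A i * (G i - C))
        \<le> real i * phi ^ i + (1 + phi) * phi ^ i"
    proof (rule always_eventually, rule allI)
      fix i
      have "\<bar>weight A i * (G i - C)\<bar> \<le> (1 + phi) * phi ^ i"
        unfolding abs_mult using weight_nonneg[of A i] weight_le[of A i] fib_times_power_phi_error[of i]
        by (intro mult_mono) (auto simp: G_def C_def)
      then show "norm ((real (entry_time A i) * phi ^ i - C * weight A i) - weight A i * (G i - C))
        \<le> real i * phi ^ i + (1 + phi) * phi ^ i"
        using entry_time_error[of A i] unfolding C_def[symmetric] real_norm_def
        by (intro order_trans[OF abs_triangle_ineq4 add_mono])
    qed
    have "(\<lambda>i. real i * phi ^ i + (1 + phi) * phi ^ i) \<longlonglongrightarrow> 0 + (1 + phi) * 0"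
      by (intro tendsto_intros phi_power_times_n_tendsto phi_power_tendsto)
    then show "(\<lambda>i. real i * phi ^ i + (1 + phi) * phi ^ i) \<longlonglongrightarrow> 0" by simp
  qed
  then have "(\<lambda>i. ((real (entry_time A i) * phi ^ i - C * weight A i) - weight A i * (G i - C)) / G i)
      \<longlonglongrightarrow> 0 / C"
    unfolding G_def C_def by (intro tendsto_divide fib_times_power_phi_tendsto limit_nonzero)
  moreover have "((real (entry_time A i) * phi ^ i - C * weight A i) - weight A i * (G i - C)) / G i
      = real (entry_time A i) / real (fib (Suc i)) - weight A i" for i
    unfolding G_def by (simp add: field_simps)
  ultimately show ?thesis by simp
qed

text \<open>
  The two quotients \<open>k / n\<close> that matter for the liminf, in the limit: an occurrence starting
  after the first hit if \<open>A i \<and> A (Suc i)\<close>, and at the origin if \<open>\<not> A i\<close>. The first factor stands for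
  \<open>1 / phi\<^sup>2 = 2 + phi\<close>.
\<close>
definition admits :: "(nat \<Rightarrow> bool) \<Rightarrow> real \<Rightarrow> nat \<Rightarrow> bool" where
  "admits A c i \<longleftrightarrow> (A i \<and> A (Suc i) \<longrightarrow> c * (2 + phi) \<le> 1 + weight A i) \<and>
     (\<not> A i \<longrightarrow> c * (weight A i + 1 + phi) \<le> 1)"

lemma le_fib_Suc: "i \<le> fib (Suc i)"
proof (induction i rule: fib.induct)
  case (3 i)
  then show ?case using fib_Suc_pos[of i] unfolding fib2[of "Suc i"] by linarith
qed auto

lemma eventually_fib_ge: "\<forall>\<^sub>F i in sequentially. N \<le> fib (Suc i)"
  using le_fib_Suc le_trans unfolding eventually_sequentially by blast

context generic_renormalization
begin

text \<open>The explicit repetitions \<open>recurs_AA\<close> and \<open>recurs_B\<close> bound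
  \<open>rep_fun\<close> from above. The sequences \<open>h\<close> and \<open>h'\<close> collect
  the differences between finite quotients and their limits, and the gap between \<open>c\<close>
  and \<open>c'\<close> absorbs them.\<close>

lemma eventually_admits:
  assumes rep: "ereal (1 + c') < rep (word y)" and c: "0 < c" "c < c'"
  shows "\<forall>\<^sub>F i in sequentially. admits A c i"
proof -
  have "\<forall>\<^sub>F n in sequentially. ereal (1 + c') < ereal (real (rep_fun n (word y)) / real n)"
    using rep unfolding rep_def by (rule less_LiminfD)
  then obtain N where N: "\<And>n. n \<ge> N \<Longrightarrow> 1 + c' < real (rep_fun n (word y)) / real n"
    unfolding eventually_sequentially by auto
  have bound: "c' * real n < real k" if "recurs (word y) k n" "n \<ge> N" "n > 0" for k n
  proof -
    have "(1 + c') * real n < real (rep_fun n (word y))"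
      using N[OF that(2)] that(3) by (simp add: field_simps)
    also have "\<dots> \<le> real n + real k" using rep_fun_le[OF that(1)] by linarith
    finally show ?thesis by (simp add: algebra_simps)
  qed
  define f where "f i = real (fib (Suc i))" for i
  define h where "h i = (real (s i) / f i - weight A i) + 1 / f i
      - c' * (f (Suc i) / f i - (1 + phi)) + 2 * c' * (1 / f i)" for i
  define h' where "h' i = c' * ((real (s i) / f i - weight A i) + (f (Suc i) / f i - (1 + phi)) - 1 / f i)" for i
  note lims = entry_time_tendsto[of A] inverse_fib_tendsto fib_ratio_tendsto
  have "h \<longlonglongrightarrow> 0 + 0 - c' * ((1 + phi) - (1 + phi)) + 2 * c' * 0"
    unfolding h_def f_def by (intro tendsto_intros lims)
  then have "h \<longlonglongrightarrow> 0" by simp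
  moreover have "h' \<longlonglongrightarrow> c' * (0 + ((1 + phi) - (1 + phi)) - 0)"
    unfolding h'_def f_def by (intro tendsto_intros lims)
  then have "h' \<longlonglongrightarrow> 0" by simp
  ultimately have "\<forall>\<^sub>F i in sequentially. h i < c' - c" "\<forall>\<^sub>F i in sequentially. - (c' - c) < h' i"
    using c by (auto intro: order_tendstoD)
  then show ?thesis using eventually_fib_ge[of "Suc (N + 2)"]
  proof eventually_elim
    case (elim i)
    have f: "f i > 0" by (simp add: f_def)
    show ?case unfolding admits_def
    proof (intro conjI impI)
      assume AA: "A i \<and> A (Suc i)"
      define n where "n = fib (Suc (Suc (Suc i))) - 2"
      have n: "n \<ge> N" "n > 0" and nr: "real n = f (Suc i) + f i - 2"
        using elim(3) by (auto simp: n_def f_def)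
      have "c' * real n < real (s i + 1 + fib (Suc i))"
        unfolding n_def by (rule bound) (use recurs_AA AA n in \<open>auto simp: n_def\<close>)
      then have "c' * (f (Suc i) + f i - 2) / f i < (real (s i) + 1 + f i) / f i"
        unfolding nr using f by (intro divide_strict_right_mono) (auto simp: f_def)
      then have "c' * (2 + phi) < 1 + weight A i + h i"
        using f unfolding h_def by (simp add: add_divide_distrib diff_divide_distrib algebra_simps)
      moreover have "(c' - c) * 1 \<le> (c' - c) * (2 + phi)"
        using c by (intro mult_left_mono) (auto intro: add_increasing2)
      ultimately show "c * (2 + phi) \<le> 1 + weight A i" using elim(1) by (simp add: algebra_simps)
    next
      assume B: "\<not> A i"
      define n where "n = s i + fib (Suc (Suc i)) - 1"
      have n: "n \<ge> N" "n > 0" and nr: "real n = real (s i) + f (Suc i) - 1"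
        using elim(3) by (auto simp: n_def f_def)
      have "c' * real n < real (fib (Suc i))"
        unfolding n_def by (rule bound) (use recurs_B B n in \<open>auto simp: n_def\<close>)
      then have "c' * (real (s i) + f (Suc i) - 1) / f i < f i / f i"
        unfolding nr using f by (intro divide_strict_right_mono) (auto simp: f_def)
      then have "c' * (weight A i + 1 + phi) + h' i < 1"
        using f unfolding h'_def by (simp add: add_divide_distrib diff_divide_distrib algebra_simps)
      moreover have "(c' - c) * 1 \<le> (c' - c) * (weight A i + 1 + phi)"
        using c weight_nonneg[of A i] by (intro mult_left_mono) (auto intro: add_increasing2)
      ultimately show "c * (weight A i + 1 + phi) \<le> 1" using elim(2) by (simp add: algebra_simps)
    qed
  qed
qed

text \<open>Every large \<open>n\<close> lies between \<open>fib (Suc (Suc m))\<close> and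
  \<open>fib (Suc (Suc (Suc m)))\<close> for one \<open>m\<close>, and
  \<open>recurs_lower_bound\<close> at this level leaves three cases. Two are controlled by
  \<open>admits\<close>; the first yields a quotient tending to \<open>phi\<close>, whence the cap
  \<open>c \<le> phi\<close>.\<close>

lemma rep_ge:
  assumes adm: "\<forall>\<^sub>F i in sequentially. admits A c i" and c: "0 < c'" "c' < c" "c \<le> phi"
  shows "ereal (1 + c') \<le> rep (word y)"
proof -
  define f where "f i = real (fib (Suc i))" for i
  define e where "e i = real (s i) / f i - weight A i" for i
  define r where "r i = f (Suc i) / f i - (1 + phi)" for i
  note lims = entry_time_tendsto[of A] inverse_fib_tendsto fib_ratio_tendsto
  have e0: "e \<longlonglongrightarrow> 0" unfolding e_def f_def by (rule lims)
  have "r \<longlonglongrightarrow> (1 + phi) - (1 + phi)" unfolding r_def f_def by (intro tendsto_intros lims)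
  then have r0: "r \<longlonglongrightarrow> 0" by simp
  have "(\<lambda>i. c' * r i - e i) \<longlonglongrightarrow> c' * 0 - 0" by (intro tendsto_intros e0 r0)
  then have t1: "\<forall>\<^sub>F i in sequentially. c' * r i - e i < c - c'"
    by (rule order_tendstoD(2)) (use c in simp)
  have "(\<lambda>i. c' * (e i + r i)) \<longlonglongrightarrow> c' * (0 + 0)" by (intro tendsto_intros e0 r0)
  then have t2: "\<forall>\<^sub>F i in sequentially. c' * (e i + r i) < c - c'"
    by (rule order_tendstoD(2)) (use c in simp)
  have "(\<lambda>i. (1 - c') * r i) \<longlonglongrightarrow> (1 - c') * 0" by (intro tendsto_intros r0)
  then have t3: "\<forall>\<^sub>F i in sequentially. (1 - c') * r i > - (c - c')"
    by (rule order_tendstoD(1)) (use c in simp)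
  from adm t1 t2 t3 have "\<forall>\<^sub>F m in sequentially. c' * f (Suc (Suc m)) \<le> f (Suc m) \<and>
      (A m \<and> A (Suc m) \<longrightarrow> c' * f (Suc (Suc m)) \<le> real (s m) + f m) \<and>
      (\<not> A m \<longrightarrow> c' * (real (s m) + f (Suc m)) \<le> f m)"
  proof eventually_elim
    case (elim i)
    have f: "f i > 0" by (simp add: f_def)
    have f2: "f (Suc (Suc i)) = f (Suc i) + f i" by (simp add: f_def)
    have f1: "f (Suc i) = f i * (r i + 1 + phi)" and si: "real (s i) = f i * (e i + weight A i)"
      using f by (simp_all add: r_def e_def field_simps)
    have gap: "(c - c') * 1 \<le> (c - c') * (2 + phi)"
      using c by (intro mult_left_mono) (auto intro: add_increasing2)
    show ?case
    proof (intro conjI impI)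
      have "c * (2 + phi) \<le> phi * (2 + phi)" using c(3) by (intro mult_right_mono) auto
      then have "c' * (r i + 2 + phi) \<le> r i + 1 + phi"
        using gap elim(4) phi_square' by (simp add: algebra_simps)
      then have "f i * (c' * (r i + 2 + phi)) \<le> f i * (r i + 1 + phi)"
        using f by (intro mult_left_mono) auto
      then show "c' * f (Suc (Suc i)) \<le> f (Suc i)" unfolding f2 f1 by (simp add: algebra_simps)
    next
      assume "A i \<and> A (Suc i)"
      then have "c * (2 + phi) \<le> 1 + weight A i" using elim(1) by (simp add: admits_def)
      then have "c' * (r i + 2 + phi) \<le> e i + weight A i + 1"
        using gap elim(2) by (simp add: algebra_simps)
      then have "f i * (c' * (r i + 2 + phi)) \<le> f i * (e i + weight A i + 1)"
        using f by (intro mult_left_mono) auto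
      then show "c' * f (Suc (Suc i)) \<le> real (s i) + f i" unfolding f2 f1 si by (simp add: algebra_simps)
    next
      assume "\<not> A i"
      then have B: "c * (weight A i + 1 + phi) \<le> 1" using elim(1) by (simp add: admits_def)
      have "(c - c') * 1 \<le> (c - c') * (weight A i + 1 + phi)"
        using c weight_nonneg[of A i] by (intro mult_left_mono) (auto intro: add_increasing2)
      then have "c' * (e i + weight A i + r i + 1 + phi) \<le> 1"
        using B elim(3) by (simp add: algebra_simps)
      then have "f i * (c' * (e i + weight A i + r i + 1 + phi)) \<le> f i * 1"
        using f by (intro mult_left_mono) auto
      then show "c' * (real (s i) + f (Suc i)) \<le> f i" unfolding f1 si by (simp add: algebra_simps)
    qed
  qed
  then obtain M where M: "\<And>m. m \<ge> M \<Longrightarrow> c' * f (Suc (Suc m)) \<le> f (Suc m) \<and>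
      (A m \<and> A (Suc m) \<longrightarrow> c' * f (Suc (Suc m)) \<le> real (s m) + f m) \<and>
      (\<not> A m \<longrightarrow> c' * (real (s m) + f (Suc m)) \<le> f m)"
    unfolding eventually_sequentially by blast
  have "1 + c' \<le> real (rep_fun n (word y)) / real n" if n: "n \<ge> fib (Suc (Suc (Suc (Suc (M + 2)))))" for n
  proof -
    have npos: "n > 0" using n fib_Suc_pos[of "Suc (Suc (Suc (M + 2)))"] by linarith
    have "finite (range (word y))"
      by (rule finite_subset[of _ "{0, 1}"]) (use word_range in auto)
    then obtain k0 where "recurs (word y) k0 n" using recurs_exists by blast
    then obtain k where k: "rep_fun n (word y) = n + k" "recurs (word y) k n"
      by (rule rep_fun_attained)
    have ex: "\<exists>m. n < fib (Suc (Suc (Suc m)))"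
      using le_fib_Suc[of "Suc (Suc n)"] by (intro exI[of _ n]) linarith
    define m where "m = (LEAST m. n < fib (Suc (Suc (Suc m))))"
    have m1: "n < fib (Suc (Suc (Suc m)))" unfolding m_def by (rule LeastI_ex[OF ex])
    have mM: "m > M + 2"
    proof (rule ccontr)
      assume "\<not> m > M + 2"
      then have "fib (Suc (Suc (Suc m))) \<le> fib (Suc (Suc (Suc (Suc (M + 2)))))" by (intro fib_mono) simp
      then show False using m1 n by linarith
    qed
    then obtain m' where m': "m = Suc m'" by (cases m) auto
    have "\<not> n < fib (Suc (Suc (Suc m')))"
      by (rule not_less_Least) (use m' in \<open>simp only: m_def[symmetric] lessI\<close>)
    then have m2: "fib (Suc (Suc m)) \<le> n" unfolding m' not_less .
    have Mm: "m \<ge> M" "m \<ge> 2" using mM by auto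
    have n1: "real n \<le> f (Suc (Suc m))" using m1 by (simp add: f_def)
    then have c1: "c' * real n \<le> c' * f (Suc (Suc m))" using c by (intro mult_left_mono) auto
    have "c' * real n \<le> real k"
      using recurs_lower_bound[OF k(2) m2 Mm(2)]
    proof (elim disjE conjE)
      assume "fib (Suc (Suc m)) \<le> k"
      then have "f (Suc m) \<le> real k" unfolding f_def by (simp only: of_nat_le_iff)
      then show ?thesis using M[OF Mm(1)] c1 by linarith
    next
      assume AA: "A m" "A (Suc m)" and "s m + fib (Suc m) \<le> k"
      then have "real (s m) + f m \<le> real k" unfolding f_def by (simp flip: of_nat_add)
      then show ?thesis using M[OF Mm(1)] AA c1 by linarith
    next
      assume B: "\<not> A m" and k: "n < s m + fib (Suc (Suc m))" "fib (Suc m) \<le> k"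
      have "real n \<le> real (s m) + f (Suc m)" unfolding f_def using k(1) by linarith
      then have "c' * real n \<le> c' * (real (s m) + f (Suc m))" using c by (intro mult_left_mono) auto
      moreover have "f m \<le> real k" using k(2) by (simp add: f_def)
      ultimately show ?thesis using M[OF Mm(1)] B by linarith
    qed
    then show ?thesis using k npos by (simp add: field_simps)
  qed
  then have "\<forall>\<^sub>F n in sequentially. ereal (1 + c') \<le> ereal (real (rep_fun n (word y)) / real n)"
    unfolding eventually_sequentially by (simp only: ereal_less_eq) blast
  then show ?thesis unfolding rep_def by (rule Liminf_bounded)
qed

lemma rep_eqI:
  assumes c: "0 < c" "c \<le> phi"
    and lower: "\<And>c'. 0 < c' \<Longrightarrow> c' < c \<Longrightarrow> \<forall>\<^sub>F i in sequentially. admits A c' i"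
    and upper: "\<And>c'. c < c' \<Longrightarrow> \<exists>\<^sub>F i in sequentially. \<not> admits A c' i"
  shows "rep (word y) = ereal (1 + c)"
proof (rule antisym)
  show "rep (word y) \<le> ereal (1 + c)"
  proof (rule ccontr)
    assume "\<not> ?thesis"
    then obtain z where z: "ereal (1 + c) < ereal z" "ereal z < rep (word y)"
      using ereal_dense2 by (metis not_le ereal_dense3 less_ereal.simps)
    define c' where "c' = (c + (z - 1)) / 2"
    have cz: "c < c'" "c' < z - 1" using z(1) by (auto simp: c'_def field_simps)
    then have "\<forall>\<^sub>F i in sequentially. admits A c' i"
      using eventually_admits[of "z - 1" c'] z(2) c by simp
    then show False using upper[OF cz(1)] by (simp add: frequently_def)
  qed
  show "ereal (1 + c) \<le> rep (word y)"
  proof (rule ccontr)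
    assume "\<not> ?thesis"
    then obtain z where z: "rep (word y) < ereal z" "ereal z < ereal (1 + c)"
      using ereal_dense2 by (metis not_le)
    define c' where "c' = max (z - 1) (c / 2)"
    have c': "0 < c'" "c' < c" "z \<le> 1 + c'" using z(2) c by (auto simp: c'_def)
    define c'' where "c'' = (c + c') / 2"
    have "0 < c''" "c'' < c" "c' < c''" using c' by (auto simp: c''_def)
    then have "ereal (1 + c') \<le> rep (word y)"
      using rep_ge[OF lower[of c''], of c'] c' c by simp
    moreover have "ereal z \<le> ereal (1 + c')" using c' by simp
    ultimately show False using z(1) by (meson leD le_less_trans not_le order_trans)
  qed
qed

end

subsection \<open>From words to itineraries and back\<close>

text \<open>The recursions express the value at \<open>k\<close> through the value at
  \<open>Suc k\<close>, contracting towards smaller indices. A bounded solution is therefore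
  determined by the recursion alone, without an initial value.\<close>

lemma contraction_imp_zero:
  fixes f :: "nat \<Rightarrow> real"
  assumes c: "0 \<le> c" "c < 1" and f: "\<And>k. \<bar>f k\<bar> \<le> c * \<bar>f (Suc k)\<bar>" and B: "\<And>k. \<bar>f k\<bar> \<le> B"
  shows "f k = 0"
proof -
  have "\<bar>f k\<bar> \<le> c ^ n * B" for n
  proof -
    have "\<bar>f k\<bar> \<le> c ^ n * \<bar>f (k + n)\<bar>"
    proof (induction n)
      case (Suc n)
      have "c ^ n * \<bar>f (k + n)\<bar> \<le> c ^ n * (c * \<bar>f (Suc (k + n))\<bar>)"
        using f c(1) by (intro mult_left_mono) auto
      then show ?case using Suc by (simp add: mult_ac)
    qed simp
    also have "\<dots> \<le> c ^ n * B" using B c(1) by (intro mult_left_mono) auto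
    finally show ?thesis .
  qed
  moreover have "(\<lambda>n. c ^ n * B) \<longlonglongrightarrow> 0 * B"
    by (intro tendsto_mult tendsto_const LIMSEQ_power_zero) (use c in simp)
  ultimately have "\<bar>f k\<bar> \<le> 0 * B" by (intro LIMSEQ_le_const) auto
  then show ?thesis by simp
qed

text \<open>The recursion for \<open>w\<close> unrolled indefinitely, which recovers the point from
  its digits.\<close>

definition expansion :: "(nat \<Rightarrow> bool) \<Rightarrow> nat \<Rightarrow> real" where
  "expansion A i = - phi * (\<Sum>k. real (step_digit A (i + k)) * (- phi) ^ k)"

lemma expansion_term_le: "norm (real (step_digit A (i + k)) * (- phi) ^ k) \<le> phi ^ k"
  by (simp add: step_digit_def abs_mult power_abs)

lemma expansion_summable: "summable (\<lambda>k. real (step_digit A (i + k)) * (- phi) ^ k)"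
  by (rule summable_comparison_test[OF _ summable_geometric[of phi]])
    (use expansion_term_le in auto)

lemma expansion_rec: "expansion A i = - phi * (expansion A (Suc i) + real (step_digit A i))"
proof -
  have "(\<Sum>k. real (step_digit A (i + Suc k)) * (- phi) ^ Suc k)
      = (\<Sum>k. - phi * (real (step_digit A (Suc i + k)) * (- phi) ^ k))"
    by (simp add: mult_ac)
  also have "\<dots> = expansion A (Suc i)"
    unfolding expansion_def by (rule suminf_mult[OF expansion_summable])
  finally show ?thesis
    using suminf_split_head[OF expansion_summable[of A i]]
    unfolding expansion_def[of A i] by (simp add: algebra_simps)
qed

lemma expansion_bounded: "\<bar>expansion A i\<bar> \<le> phi * (1 / (1 - phi))"
proof -
  have "norm (\<Sum>k. real (step_digit A (i + k)) * (- phi) ^ k) \<le> (\<Sum>k. phi ^ k)"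
    by (rule norm_suminf_le[OF expansion_term_le summable_geometric]) simp
  also have "\<dots> = 1 / (1 - phi)" by (rule suminf_geometric) simp
  finally show ?thesis unfolding expansion_def by (simp add: abs_mult mult_left_mono del: times_divide_eq_right)
qed

lemma expansion_range:
  assumes A: "\<And>i. \<not> A i \<Longrightarrow> A (Suc i)"
  shows "(A i \<longrightarrow> - phi \<le> expansion A i \<and> expansion A i \<le> 0)
    \<and> (\<not> A i \<longrightarrow> 0 \<le> expansion A i \<and> expansion A i \<le> phi ^ 2)"
proof -
  let ?w = "expansion A"
  \<comment> \<open>The distance of \<open>expansion A i\<close> from the closed interval assigned
    to its letter. One step of the recursion maps the interval of the next letter into that of the
    current one and contracts by \<open>phi\<close>, so this bounded distance vanishes.\<close>
  define v where "v i = (if A i then max 0 (max (?w i) (- phi - ?w i))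
    else max 0 (max (- ?w i) (?w i - phi ^ 2)))" for i
  have v0: "v i \<ge> 0" for i by (simp add: v_def)
  have "v i = 0"
  proof (rule contraction_imp_zero[of phi v])
    show "\<bar>v i\<bar> \<le> phi * \<bar>v (Suc i)\<bar>" for i
    proof -
      have le: "phi * x \<le> phi * v (Suc i)" if "x \<le> v (Suc i)" for x
        using that by (intro mult_left_mono) auto
      have "v i \<le> phi * v (Suc i)"
      proof (cases "A i")
        case True
        show ?thesis
        proof (cases "A (Suc i)")
          case S: True
          have w: "?w i = - phi * ?w (Suc i) - phi"
            using expansion_rec[of A i] True S by (simp add: step_digit_def algebra_simps)
          have "phi * (- phi - ?w (Suc i)) \<le> phi * v (Suc i)" "phi * ?w (Suc i) \<le> phi * v (Suc i)"
            by (rule le; simp add: v_def S)+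
          then have "- (phi * phi) - phi * ?w (Suc i) \<le> phi * v (Suc i)" "phi * ?w (Suc i) \<le> phi * v (Suc i)"
            by (simp_all only: right_diff_distrib mult_minus_right)
          moreover have "phi * phi \<le> phi" by simp
          moreover have "?w i = - (phi * ?w (Suc i)) - phi" using w by simp
          ultimately have "?w i \<le> phi * v (Suc i)" "- phi - ?w i \<le> phi * v (Suc i)"
            by linarith+
          then show ?thesis using True v0[of "Suc i"] by (simp add: v_def[of i])
        next
          case S: False
          have w: "?w i = - phi * ?w (Suc i)"
            using expansion_rec[of A i] True S by (simp add: step_digit_def algebra_simps)
          have "phi * (- ?w (Suc i)) \<le> phi * v (Suc i)" "phi * (?w (Suc i) - phi ^ 2) \<le> phi * v (Suc i)"
            by (rule le; simp add: v_def S)+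
          then have "- (phi * ?w (Suc i)) \<le> phi * v (Suc i)"
            "phi * ?w (Suc i) - phi * phi ^ 2 \<le> phi * v (Suc i)"
            by (simp_all only: right_diff_distrib mult_minus_right)
          moreover have "phi * phi ^ 2 \<le> phi"
            using small_cube by (simp only: power2_eq_square power3_eq_cube mult.assoc)
          moreover have "?w i = - (phi * ?w (Suc i))" using w by simp
          ultimately have "?w i \<le> phi * v (Suc i)" "- phi - ?w i \<le> phi * v (Suc i)"
            by linarith+
          then show ?thesis using True v0[of "Suc i"] by (simp add: v_def[of i])
        qed
      next
        case False
        then have S: "A (Suc i)" by (rule A)
        have w: "?w i = - phi * ?w (Suc i)"
          using expansion_rec[of A i] False by (simp add: step_digit_def algebra_simps)
        have "phi * (- phi - ?w (Suc i)) \<le> phi * v (Suc i)" "phi * ?w (Suc i) \<le> phi * v (Suc i)"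
          by (rule le; simp add: v_def S)+
        then have "?w i - phi ^ 2 \<le> phi * v (Suc i)" "- ?w i \<le> phi * v (Suc i)"
          unfolding w by (simp_all add: algebra_simps power2_eq_square)
        then show ?thesis using False v0[of "Suc i"] by (simp add: v_def[of i])
      qed
      then show ?thesis using v0 by simp
    qed
    show "\<bar>v i\<bar> \<le> phi * (1 / (1 - phi)) + phi" for i
    proof -
      define B where "B = phi * (1 / (1 - phi)) + phi"
      have "phi ^ 2 \<ge> 0" by simp
      then have "?w i \<le> B" "- phi - ?w i \<le> B" "- ?w i \<le> B" "?w i - phi ^ 2 \<le> B" "0 \<le> B"
        using expansion_bounded[of A i] phi_pos unfolding B_def by linarith+
      then show ?thesis using v0[of i] unfolding B_def[symmetric] by (simp add: v_def)
    qed
  qed auto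
  then show ?thesis by (auto simp: v_def max_def split: if_splits)
qed

text \<open>Only the end points of the closed intervals must be excluded. The value 0 would make all
  later digits 0, against infinitely many \<open>AA\<close>; \<open>- phi\<close> would require 0 or
  1 at the next level; and \<open>phi ^ 2\<close> would require \<open>- phi\<close> there.\<close>

lemma renormalization_expansion:
  assumes A: "\<And>i. \<not> A i \<Longrightarrow> A (Suc i)" and inf: "\<And>m. \<exists>i\<ge>m. A i \<and> A (Suc i)"
  shows "renormalization (expansion A 0) A (expansion A)"
proof -
  let ?w = "expansion A"
  have bound: "- phi \<le> ?w i" "?w i \<le> phi ^ 2" for i
    using expansion_range[of A i, OF A] phi_pos zero_le_power2[of phi] by (cases "A i"; linarith)+
  have sq: "phi ^ 2 < 1" using phi_pos by (simp add: phi_square)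
  have step0: "?w (Suc i) = 0 \<and> step_digit A i = 0" if "?w i = 0" for i
  proof -
    have e: "?w (Suc i) + real (step_digit A i) = 0" using that expansion_rec[of A i] by simp
    have "step_digit A i = 0"
    proof (rule ccontr)
      assume "step_digit A i \<noteq> 0"
      then have "real (step_digit A i) = 1" by (simp add: step_digit_def)
      then show False using e bound(1)[of "Suc i"] phi_less_1 by linarith
    qed
    then show ?thesis using e by simp
  qed
  have nz: "?w i \<noteq> 0" for i
  proof
    assume "?w i = 0"
    then have "?w (i + k) = 0" for k by (induction k) (use step0 in auto)
    then have "step_digit A j = 0" if "j \<ge> i" for j
      using step0[of j] that le_Suc_ex by blast
    then show False using inf[of i] by (force simp: step_digit_def)
  qed
  have sign: "A i \<longleftrightarrow> ?w i < 0" for i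
    using expansion_range[of A i, OF A] nz[of i] by (cases "A i") linarith+
  have low: "?w i \<noteq> - phi" for i
  proof
    assume w: "?w i = - phi"
    have "phi * (?w (Suc i) + real (step_digit A i)) = phi * 1" using expansion_rec[of A i] w by simp
    then have "?w (Suc i) + real (step_digit A i) = 1" by (simp only: mult_cancel_left) simp
    moreover have "real (step_digit A i) = 0 \<or> real (step_digit A i) = 1" by (simp add: step_digit_def)
    ultimately show False using nz[of "Suc i"] bound(2)[of "Suc i"] sq by auto
  qed
  have high: "?w i \<noteq> phi ^ 2" for i
  proof
    assume w: "?w i = phi ^ 2"
    then have "\<not> A i" using sign[of i] by simp
    then have "phi * (- ?w (Suc i)) = phi * phi"
      using expansion_rec[of A i] w by (simp add: step_digit_def power2_eq_square)
    then have "- ?w (Suc i) = phi" by (simp only: mult_cancel_left) simp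
    then show False using low[of "Suc i"] by linarith
  qed
  show ?thesis
  proof
    show "\<exists>N::int. ?w 0 - of_int N = ?w 0" by (rule exI[of _ 0]) simp
    show "- phi < ?w i" "?w i < phi ^ 2" for i
      using bound[of i] low[of i] high[of i] by linarith+
    show "?w i \<noteq> 0" "A i \<longleftrightarrow> ?w i < 0" for i by (rule nz, rule sign)
    show "?w i = - phi * (?w (Suc i) + real (step_digit A i))" for i by (rule expansion_rec)
  qed
qed

lemma (in renormalization) digit_iff: "step_digit A i = of_bool (w i < - (phi ^ 3))"
proof -
  have "w i < - (phi ^ 3) \<longleftrightarrow> A i \<and> A (Suc i)"
    using digit_1[of i] digit_0[of i] sign[of i] zero_less_power[OF phi_pos, of 3] by linarith
  then show ?thesis by (simp add: step_digit_def)
qed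

text \<open>By \<open>digit_iff\<close> the point \<open>w i\<close> determines its digit, and the
  recursion then determines \<open>w (Suc i)\<close>.\<close>

lemma itinerary_unique:
  assumes "renormalization y A w" "renormalization y' A' w'" "w 0 = w' 0"
  shows "A = A'"
proof -
  interpret r: renormalization y A w by fact
  interpret r': renormalization y' A' w' by fact
  have "w i = w' i" for i
  proof (induction i)
    case (Suc i)
    have eq: "step_digit A i = step_digit A' i" unfolding r.digit_iff r'.digit_iff Suc ..
    have "- phi * (w (Suc i) + real (step_digit A i)) = w i" by (rule r.rec[symmetric])
    also have "\<dots> = w' i" by (rule Suc)
    also have "\<dots> = - phi * (w' (Suc i) + real (step_digit A' i))" by (rule r'.rec)
    finally show ?case unfolding eq by (simp only: mult_cancel_left) simp
  qed (fact assms(3))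
  then show ?thesis using r.sign r'.sign by auto
qed

section \<open>The correspondence between points and Sturmian words\<close>

lemma floor_diff_word: "\<lfloor>real t * phi + y\<rfloor> = \<lfloor>y\<rfloor> + (\<Sum>k<t. word y k)"
  by (induction t) (simp_all add: word_def)

text \<open>Equal words give equal floors along two orbits that differ by a constant
  \<open>e\<close> after an integer translation. If \<open>e\<close> is nonzero, it exceeds the
  displacement of some deep level in the same direction, and a hit of that level changes the
  floor.\<close>

lemma word_inj:
  assumes y: "generic y" and eq: "word y = word y'" and close: "\<bar>y' - y\<bar> < 1"
  shows "y = y'"
proof (rule ccontr)
  assume neq: "y \<noteq> y'"
  define e where "e = y' - y + of_int (\<lfloor>y\<rfloor> - \<lfloor>y'\<rfloor>)"
  have fl: "\<lfloor>real t * phi + y + e\<rfloor> = \<lfloor>real t * phi + y\<rfloor>" for t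
  proof -
    have "real t * phi + y + e = real t * phi + y' + of_int (\<lfloor>y\<rfloor> - \<lfloor>y'\<rfloor>)" by (simp add: e_def)
    then have "\<lfloor>real t * phi + y + e\<rfloor> = \<lfloor>real t * phi + y'\<rfloor> + (\<lfloor>y\<rfloor> - \<lfloor>y'\<rfloor>)"
      by (simp only: floor_add_int[symmetric])
    then show ?thesis using eq by (simp add: floor_diff_word)
  qed
  have "e \<noteq> 0"
  proof
    assume "e = 0"
    then have "y' - y = of_int (\<lfloor>y'\<rfloor> - \<lfloor>y\<rfloor>)" by (simp add: e_def)
    then show False using close neq by (metis eq_iff_diff_eq_0 of_int_0 of_int_abs of_int_less_1_iff zero_less_abs_iff abs_zero not_less zabs_less_one_iff)
  qed
  obtain k where k: "phi ^ k < \<bar>e\<bar>" using real_arch_pow_inv[of "\<bar>e\<bar>" phi] \<open>e \<noteq> 0\<close> by auto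
  \<comment> \<open>The parity gives \<open>(- phi) ^ i\<close> the sign of \<open>e\<close>, and
    \<open>2 * k\<close> makes the level deep enough.\<close>
  define i where "i = (if e > 0 then 2 * k else Suc (2 * k))"
  define c where "c = e / (phi * (- phi) ^ i)"
  have small: "phi ^ Suc i \<le> phi ^ k" by (rule power_decreasing) (auto simp: i_def)
  have "\<bar>phi * (- phi) ^ i\<bar> \<le> \<bar>e\<bar>" using small k by (simp add: abs_mult power_abs)
  moreover have "c = \<bar>e\<bar> / \<bar>phi * (- phi) ^ i\<bar>"
    using \<open>e \<noteq> 0\<close> unfolding c_def i_def by (auto simp: abs_mult power_abs)
  ultimately have c: "c \<ge> 1" by (simp add: le_divide_eq_1)
  obtain t where "hit y i t" using hit_within[OF y] by blast
  moreover have "phi * (- phi) ^ i * c = e" by (simp add: c_def)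
  ultimately show False using hit_floor_neq[of y i t c] c fl[of t] by simp
qed

lemma sturmian_word_word: "sturmian_word phi (word y)"
  unfolding sturmian_word_def
proof (intro conjI exI[of _ "y - phi"] disjI1 allI impI)
  show "range (word y) \<subseteq> {0, 1}" using word_range by blast
  fix n :: nat assume "n \<ge> 1"
  then obtain t where t: "n = Suc t" by (cases n) auto
  show "word y (n - 1) = \<lfloor>real (n + 1) * phi + (y - phi)\<rfloor> - \<lfloor>real n * phi + (y - phi)\<rfloor>"
    unfolding word_def t by (simp add: algebra_simps)
qed (use phi_not_rat in auto)

lemma countable_not_generic: "countable {y. \<not> generic y}"
proof -
  have "{y. \<not> generic y} \<subseteq> (\<lambda>(n::nat, N::int). of_int N - real n * phi) ` UNIV"
  proof
    fix y assume "y \<in> {y. \<not> generic y}"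
    then obtain n :: nat and N :: int where "real n * phi + y = of_int N"
      unfolding generic_def Ints_def by auto
    then have "y = (\<lambda>(n::nat, N::int). of_int N - real n * phi) (n, N)" by simp
    then show "y \<in> (\<lambda>(n::nat, N::int). of_int N - real n * phi) ` UNIV" by blast
  qed
  then show ?thesis by (rule countable_subset) auto
qed

text \<open>Off the integers the ceiling is the floor plus 1, so a ceiling word over a generic point
  is a floor word. The shift from \<open>\<rho>\<close> to \<open>phi + \<rho>\<close> comes from
  indexing words from 0.\<close>

lemma sturmian_word_cases:
  assumes "sturmian_word phi x"
  obtains (floor) y where "x = word y"
    | (ceiling) y where "\<not> generic y" "x = (\<lambda>t. \<lceil>real (Suc t) * phi + y\<rceil> - \<lceil>real t * phi + y\<rceil>)"
proof -
  obtain \<rho> where "(\<forall>n\<ge>1. x (n - 1) = \<lfloor>real (n + 1) * phi + \<rho>\<rfloor> - \<lfloor>real n * phi + \<rho>\<rfloor>) \<or>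
        (\<forall>n\<ge>1. x (n - 1) = \<lceil>real (n + 1) * phi + \<rho>\<rceil> - \<lceil>real n * phi + \<rho>\<rceil>)"
    using assms unfolding sturmian_word_def by blast
  then show ?thesis
  proof
    assume x: "\<forall>n\<ge>1. x (n - 1) = \<lfloor>real (n + 1) * phi + \<rho>\<rfloor> - \<lfloor>real n * phi + \<rho>\<rfloor>"
    have "x t = word (phi + \<rho>) t" for t
      using x[rule_format, of "Suc t"] by (simp add: word_def algebra_simps)
    then show ?thesis using floor by blast
  next
    assume x: "\<forall>n\<ge>1. x (n - 1) = \<lceil>real (n + 1) * phi + \<rho>\<rceil> - \<lceil>real n * phi + \<rho>\<rceil>"
    have xc: "x t = \<lceil>real (Suc t) * phi + (phi + \<rho>)\<rceil> - \<lceil>real t * phi + (phi + \<rho>)\<rceil>" for t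
      using x[rule_format, of "Suc t"] by (simp add: algebra_simps)
    show ?thesis
    proof (cases "generic (phi + \<rho>)")
      case True
      then have "\<lceil>real t * phi + (phi + \<rho>)\<rceil> = \<lfloor>real t * phi + (phi + \<rho>)\<rfloor> + 1" for t
        unfolding generic_def by (simp add: ceiling_altdef)
          (metis Ints_of_int)
      then have "x = word (phi + \<rho>)" unfolding word_def using xc by (auto simp del: of_nat_Suc)
      then show ?thesis by (rule floor)
    next
      case False
      then show ?thesis using ceiling xc by blast
    qed
  qed
qed

text \<open>By \<open>entry_point\<close>, \<open>y\<close> is recovered from \<open>w M\<close>,
  the level \<open>M\<close>, the entry time and an integer translation, so countably many values of
  \<open>w M\<close> allow only countably many \<open>y\<close>.\<close>

lemma countable_if_eventually_fixed:
  assumes C: "countable C"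
    and fixed: "\<And>y A w. generic_renormalization y A w \<Longrightarrow> rep (word y) = ereal \<alpha> \<Longrightarrow> \<exists>M. w M \<in> C"
  shows "countable {x. sturmian_word phi x \<and> rep x = ereal \<alpha>}"
proof -
  define pt where "pt = (\<lambda>(c, M::nat, n::nat, N::int). c * (- phi) ^ M - real n * phi + of_int N)"
  define S where "S = pt ` (C \<times> UNIV)"
  define G where "G = {y. \<not> generic y}"
  have "{x. sturmian_word phi x \<and> rep x = ereal \<alpha>} \<subseteq>
    word ` (S \<union> G) \<union> (\<lambda>y t. \<lceil>real (Suc t) * phi + y\<rceil> - \<lceil>real t * phi + y\<rceil>) ` G"
  proof
    fix x assume "x \<in> {x. sturmian_word phi x \<and> rep x = ereal \<alpha>}"
    then have x: "sturmian_word phi x" "rep x = ereal \<alpha>" by auto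
    from x(1) show "x \<in> word ` (S \<union> G) \<union> (\<lambda>y t. \<lceil>real (Suc t) * phi + y\<rceil> - \<lceil>real t * phi + y\<rceil>) ` G"
    proof (cases rule: sturmian_word_cases)
      case (floor y)
      show ?thesis
      proof (cases "generic y")
        case True
        obtain A w where r: "renormalization y A w" using generic_renormalization[OF True] by blast
        then interpret generic_renormalization y A w
          using True by (simp add: generic_renormalization_def generic_renormalization_axioms_def)
        obtain M where M: "w M \<in> C" using fixed[OF generic_renormalization_axioms] x(2) floor by blast
        obtain N :: int where "real (s M) * phi + y - of_int N = w M * (- phi) ^ M"
          using entry_point by blast
        then have "y = pt (w M, M, s M, N)" by (simp add: pt_def)
        then have "y \<in> S" using M by (auto simp: S_def)
        then show ?thesis using floor by blast
      next
        case False
        then show ?thesis using floor by (auto simp: G_def)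
      qed
    next
      case (ceiling y)
      then show ?thesis by (auto simp: G_def)
    qed
  qed
  moreover have "countable S" unfolding S_def using C by auto
  moreover have "countable G" unfolding G_def by (rule countable_not_generic)
  ultimately show ?thesis by (meson countable_Un countable_image countable_subset)
qed

text \<open>Sets \<open>E\<close> embed into the points through their itineraries, and all these
  points lie in one interval of length 1, where \<open>word\<close> is injective on generic points.
  Discarding the countably many nongeneric ones leaves an uncountable set.\<close>

lemma uncountable_if_family:
  fixes fam :: "nat set \<Rightarrow> nat \<Rightarrow> bool"
  assumes inj: "inj fam" and A: "\<And>E i. \<not> fam E i \<Longrightarrow> fam E (Suc i)"
    and inf: "\<And>E m. \<exists>i\<ge>m. fam E i \<and> fam E (Suc i)"
    and rep: "\<And>y E w. generic_renormalization y (fam E) w \<Longrightarrow> rep (word y) = ereal \<beta>"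
  shows "uncountable {x. sturmian_word phi x \<and> rep x = ereal \<beta>}"
proof
  assume cnt: "countable {x. sturmian_word phi x \<and> rep x = ereal \<beta>}"
  define P where "P E = expansion (fam E) 0" for E
  have ren: "renormalization (P E) (fam E) (expansion (fam E))" for E
    unfolding P_def by (rule renormalization_expansion) (use A inf in auto)
  have injP: "inj P"
  proof (rule injI)
    fix E E' assume "P E = P E'"
    then have "fam E = fam E'" using itinerary_unique[OF ren[of E] ren[of E']] by (simp add: P_def)
    then show "E = E'" using inj by (simp add: inj_eq)
  qed
  have range: "- phi < P E" "P E < phi ^ 2" for E
    using renormalization.range[OF ren[of E], of 0] by (simp_all add: P_def)
  define Y where "Y = {y \<in> range P. generic y}"
  have "inj_on word Y"
  proof (rule inj_onI)
    fix y y' assume y: "y \<in> Y" "y' \<in> Y" "word y = word y'"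
    then obtain E E' where "y = P E" "y' = P E'" "generic y" by (auto simp: Y_def)
    then have "\<bar>y' - y\<bar> < 1" using range[of E] range[of E'] phi_square by simp
    then show "y = y'" using word_inj y \<open>generic y\<close> by blast
  qed
  moreover have "word ` Y \<subseteq> {x. sturmian_word phi x \<and> rep x = ereal \<beta>}"
  proof
    fix x assume "x \<in> word ` Y"
    then obtain E where E: "generic (P E)" "x = word (P E)" by (auto simp: Y_def)
    then have "generic_renormalization (P E) (fam E) (expansion (fam E))"
      using ren[of E] by (simp add: generic_renormalization_def generic_renormalization_axioms_def)
    then show "x \<in> {x. sturmian_word phi x \<and> rep x = ereal \<beta>}"
      using rep E sturmian_word_word by blast
  qed
  ultimately have "countable Y" using cnt by (meson countable_image_inj_on countable_subset)
  then have "countable (Y \<union> {y. \<not> generic y})" using countable_not_generic by blast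
  moreover have "range P \<subseteq> Y \<union> {y. \<not> generic y}" by (auto simp: Y_def)
  ultimately have "countable (range P)" using countable_subset by blast
  then have "countable (UNIV :: nat set set)" using injP countable_image_inj_on by blast
  then obtain g :: "nat set \<Rightarrow> nat" where "inj g" by (auto elim: countableE)
  then have "surj (inv g)" by (rule inj_imp_surj_inv)
  then show False using Cantors_theorem[of UNIV] by (metis Pow_UNIV)
qed

subsection \<open>Itineraries with a large exponent of repetition\<close>

lemma phi_power_bounds:
  "38196 / 100000 < phi ^ 2" "phi ^ 2 < 38197 / 100000" "23606 / 100000 < phi ^ 3" "phi ^ 3 < 23608 / 100000"
  "14588 / 100000 < phi ^ 4" "phi ^ 4 < 14591 / 100000" "5568 / 100000 < phi ^ 6" "phi ^ 6 < 5576 / 100000"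
  unfolding phi_powers phi_square using phi_bounds by linarith+

context renormalization
begin

lemma w_le_1: "\<bar>w i\<bar> \<le> 1"
  using range[of i] phi_pos phi_less_1 phi_square by linarith

text \<open>Weights propagate forward along a block and decide which block may follow; the identity
  for \<open>w\<close> runs backward and, iterated over a periodic tail, identifies the point. The
  same pair is used for all block lengths.\<close>

lemma block_1:
  assumes "\<not> A b" "\<not> A (b + 2)"
  shows "weight A (b + 2) = phi ^ 2 * weight A b" "w b = phi ^ 2 * w (b + 2)"
proof -
  have "d b = 0" "d (Suc b) = 0" using assms by (simp_all add: step_digit_def)
  then show "weight A (b + 2) = phi ^ 2 * weight A b" by (simp add: power2_eq_square)
  have "w b = - phi * w (Suc b)" "w (Suc b) = - phi * w (b + 2)"
    using rec[of b] rec[of "Suc b"] \<open>d b = 0\<close> \<open>d (Suc b) = 0\<close> by simp_all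
  then show "w b = phi ^ 2 * w (b + 2)" by (simp add: power2_eq_square)
qed

lemma block_2:
  assumes "\<not> A b" "A (b + 2)" "\<not> A (b + 3)"
  shows "weight A (b + 3) = phi ^ 3 * weight A b + phi ^ 2" "w b = phi ^ 2 - phi ^ 3 * w (b + 3)"
proof -
  have A1: "A (Suc b)" using after_not_A assms by simp
  have d: "d b = 0" "d (Suc b) = 1" "d (b + 2) = 0"
    using assms A1 by (simp_all add: step_digit_def numeral_3_eq_3)
  then show "weight A (b + 3) = phi ^ 3 * weight A b + phi ^ 2"
    by (simp add: power2_eq_square power3_eq_cube numeral_3_eq_3 algebra_simps)
  have "w b = - phi * w (Suc b)" "w (Suc b) = - phi * (w (b + 2) + 1)" "w (b + 2) = - phi * w (b + 3)"
    using rec[of b] rec[of "Suc b"] rec[of "b + 2"] d by (simp_all add: numeral_3_eq_3)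
  then show "w b = phi ^ 2 - phi ^ 3 * w (b + 3)"
    by (simp only: power2_eq_square power3_eq_cube) (simp add: algebra_simps)
qed

lemma block_3:
  assumes "\<not> A b" "A (b + 2)" "A (b + 3)" "\<not> A (b + 4)"
  shows "weight A (b + 4) = phi ^ 4 * weight A b + phi" "w b = phi ^ 4 + phi ^ 4 * w (b + 4)"
proof -
  have A1: "A (Suc b)" using after_not_A assms by simp
  have d: "d b = 0" "d (Suc b) = 1" "d (b + 2) = 1" "d (b + 3) = 0"
    using assms A1 by (simp_all add: step_digit_def eval_nat_numeral)
  have "weight A (b + 4) = phi ^ 4 * weight A b + (phi ^ 3 + phi ^ 2)"
    using d by (simp add: eval_nat_numeral algebra_simps)
  then show "weight A (b + 4) = phi ^ 4 * weight A b + phi" by (simp add: phi_powers phi_square)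
  have e: "w b = - phi * w (Suc b)" "w (Suc b) = - phi * (w (b + 2) + 1)"
    "w (b + 2) = - phi * (w (b + 3) + 1)" "w (b + 3) = - phi * w (b + 4)"
    using rec[of b] rec[of "Suc b"] rec[of "b + 2"] rec[of "b + 3"] d
    by (simp_all add: eval_nat_numeral)
  have "w b = (phi ^ 2 - phi ^ 3) + phi ^ 4 * w (b + 4)"
    unfolding e by (simp add: algebra_simps power2_eq_square power3_eq_cube power4_eq_xxxx)
  then show "w b = phi ^ 4 + phi ^ 4 * w (b + 4)" by (simp add: phi_powers phi_square)
qed

lemma long_block_weight:
  assumes "A i" "A (i + 1)" "A (i + 2)" "A (i + 3)" "\<not> A (i + 4)"
  shows "weight A (i + 4) > 66 / 100"
proof -
  have d: "d i = 1" "d (Suc i) = 1" "d (i + 2) = 1" "d (i + 3) = 0"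
    using assms by (simp_all add: step_digit_def eval_nat_numeral)
  have "weight A (i + 4) = phi ^ 4 * weight A i + (phi ^ 4 + phi ^ 3 + phi ^ 2)"
    using d by (simp add: eval_nat_numeral algebra_simps)
  moreover have "phi ^ 4 * weight A i \<ge> 0" by (simp add: weight_nonneg)
  ultimately show ?thesis using phi_power_bounds by linarith
qed

text \<open>
  If \<^term>\<open>A\<close> fails infinitely often, the itinerary splits into blocks between consecutive failures.
  The bounds leave only three kinds of blocks, and the weight at a failure decides which
  block may follow: eventually all blocks have length 3, or lengths 2 and 4 alternate.
\<close>
lemma eventually_fixed_point:
  assumes ev: "\<forall>\<^sub>F i in sequentially. admits A (439 / 1000) i"
  shows "\<exists>M. w M \<in> {- (phi ^ 2), phi ^ 2 / (1 + phi ^ 3), phi ^ 6 / (1 - phi ^ 6)}"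
proof (cases "\<exists>m. \<forall>i\<ge>m. A i")
  case True
  then obtain m where m: "\<And>i. i \<ge> m \<Longrightarrow> A i" by blast
  \<comment> \<open>The value \<open>- (phi ^ 2)\<close> solves \<open>w = - phi * (w + 1)\<close>,
    the recursion along a tail of \<open>A\<close>.\<close>
  define f where "f k = w (m + k) + phi ^ 2" for k
  have "f 0 = 0"
  proof (rule contraction_imp_zero[of phi f])
    show "\<bar>f k\<bar> \<le> phi * \<bar>f (Suc k)\<bar>" for k
    proof -
      have "d (m + k) = 1" using m by (simp add: step_digit_def)
      then have "w (m + k) = - phi * (w (Suc (m + k)) + 1)" using rec[of "m + k"] by simp
      then have "f k = - phi * f (Suc k) + (phi ^ 3 + phi ^ 2 - phi)"
        by (simp add: f_def algebra_simps power2_eq_square power3_eq_cube)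
      then have "f k = - phi * f (Suc k)" by (simp add: phi_powers phi_square)
      then show ?thesis by (simp add: abs_mult)
    qed
    show "\<bar>f k\<bar> \<le> 2" for k
      using w_le_1[of "m + k"] phi_power_bounds(1,2) unfolding f_def by linarith
  qed auto
  then show ?thesis by (auto simp: f_def add_eq_0_iff intro!: exI[of _ m])
next
  case False
  then have often: "\<exists>i\<ge>m. \<not> A i" for m by blast
  obtain N where N: "\<And>i. i \<ge> N \<Longrightarrow> admits A (439 / 1000) i"
    using ev unfolding eventually_sequentially by blast
  define t where "t = weight A"
  have t_nonneg: "t b \<ge> 0" for b unfolding t_def by (rule weight_nonneg)
  \<comment> \<open>The bound rounds up \<open>1 / 0.439 - 1 - phi\<close>, about 0.6599.\<close>
  have t_upper: "t b \<le> 66 / 100" if "b \<ge> N" "\<not> A b" for b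
  proof -
    have "439 / 1000 * (t b + 1 + phi) \<le> 1" using N[OF that(1)] that(2) by (simp add: admits_def t_def)
    then show ?thesis using phi_bounds unfolding distrib_left by linarith
  qed
  \<comment> \<open>An \<open>AA\<close> right after the \<open>B\<close> at \<open>b\<close>
    requires \<open>0.439 * (2 + phi) \<le> 1 + phi * t b\<close>, that is, \<open>t b\<close> at
    least about 0.2416. Below 0.24 only \<open>BAB\<close> can follow, and it lowers the weight
    further.\<close>
  have only_block_1: "\<not> A (b + 2) \<and> t (b + 2) < 24 / 100" if b: "b \<ge> N" "\<not> A b" "t b < 24 / 100" for b
  proof
    have A1: "A (Suc b)" using after_not_A b by simp
    show B2: "\<not> A (b + 2)"
    proof
      assume "A (b + 2)"
      then have "439 / 1000 * (2 + phi) \<le> 1 + t (Suc b)"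
        using N[of "Suc b"] b A1 unfolding admits_def t_def by simp
      moreover have "t (Suc b) = phi * t b" using b by (simp add: t_def step_digit_def)
      moreover have "phi * t b \<le> 61804 / 100000 * (24 / 100)"
        using b t_nonneg[of b] phi_bounds by (intro mult_mono) auto
      ultimately show False using phi_bounds unfolding distrib_left by linarith
    qed
    have "phi ^ 2 * t b \<le> 1 * t b" using t_nonneg[of b] phi_power_bounds by (intro mult_right_mono) auto
    then show "t (b + 2) < 24 / 100" using block_1(1)[OF b(2) B2] b(3) unfolding t_def by linarith
  qed
  have t_lower: "t b \<ge> 24 / 100" if b: "b \<ge> N" "\<not> A b" for b
  proof (rule ccontr)
    assume "\<not> ?thesis"
    then have k: "\<not> A (b + 2 * k) \<and> t (b + 2 * k) < 24 / 100" for k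
    proof (induction k)
      case (Suc k)
      then show ?case using only_block_1[of "b + 2 * k"] b by simp
    qed (use b in auto)
    \<comment> \<open>A tail of alternating \<open>B\<close> and \<open>A\<close> would force
      \<open>w b = 0\<close>, which \<open>nonzero\<close> excludes.\<close>
    define f where "f k = w (b + 2 * k)" for k
    have "f 0 = 0"
    proof (rule contraction_imp_zero[of "phi ^ 2" f])
      show "\<bar>f k\<bar> \<le> phi ^ 2 * \<bar>f (Suc k)\<bar>" for k
        using block_1(2)[of "b + 2 * k"] k[of k] k[of "Suc k"] by (simp add: f_def abs_mult add.commute)
    qed (use w_le_1 phi_power_bounds in \<open>auto simp: f_def\<close>)
    then show False using nonzero[of b] by (simp add: f_def)
  qed
  have blocks: "\<not> A (b + 2) \<or> A (b + 2) \<and> \<not> A (b + 3) \<or> A (b + 2) \<and> A (b + 3) \<and> \<not> A (b + 4)"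
    if b: "b \<ge> N" "\<not> A b" for b
  proof (rule ccontr)
    assume neg: "\<not> ?thesis"
    have ex: "\<exists>b'. b' > b \<and> \<not> A b'" using often[of "Suc b"] by (auto simp: Suc_le_eq)
    define b' where "b' = (LEAST b'. b' > b \<and> \<not> A b')"
    have b': "b' > b" "\<not> A b'" using LeastI_ex[OF ex] unfolding b'_def by blast+
    have between: "A i" if "b < i" "i < b'" for i
      using not_less_Least[of i "\<lambda>b'. b' > b \<and> \<not> A b'"] that unfolding b'_def by blast
    have "A (b + 1)" using after_not_A b by simp
    have "b' \<noteq> b + 1" "b' \<noteq> b + 2" "b' \<noteq> b + 3" "b' \<noteq> b + 4" using b' \<open>A (b + 1)\<close> neg by metis+
    then have "b' \<ge> b + 5" using b'(1) by linarith
    define i where "i = b' - 4"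
    have i: "b' = i + 4" "i > b" using \<open>b' \<ge> b + 5\<close> by (auto simp: i_def)
    have "weight A b' > 66 / 100"
      unfolding i(1) by (rule long_block_weight) (use between b' i in auto)
    then show False using t_upper[of b'] b' b unfolding t_def by simp
  qed
  have mult_bounds: "l * (24 / 100) \<le> c * t b \<and> c * t b \<le> u * (66 / 100)"
    if "b \<ge> N" "\<not> A b" "0 \<le> l" "l < c" "c < u" for b l c u
    using t_lower[OF that(1,2)] t_upper[OF that(1,2)] that(3-5)
    by (intro conjI mult_mono; linarith)
  show ?thesis
  \<comment> \<open>This range contains every weight \<open>phi ^ 3 * t b + phi ^ 2\<close> reached
    after a block of length 3. From it a block of length 2 drops below 0.24 and one of length 4
    exceeds 0.66, so the range is never left.\<close>
  proof (cases "\<exists>b\<ge>N. \<not> A b \<and> 38 / 100 \<le> t b \<and> t b \<le> 54 / 100")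
    case True
    then obtain b where b: "b \<ge> N" "\<not> A b" "38 / 100 \<le> t b" "t b \<le> 54 / 100" by blast
    have step: "A (b + 2) \<and> \<not> A (b + 3) \<and> 38 / 100 \<le> t (b + 3) \<and> t (b + 3) \<le> 54 / 100"
      if b: "b \<ge> N" "\<not> A b" "38 / 100 \<le> t b" "t b \<le> 54 / 100" for b
    proof -
      have m: "phi ^ 2 * t b \<le> 38197 / 100000 * (54 / 100)" "14588 / 100000 * (38 / 100) \<le> phi ^ 4 * t b"
        "phi ^ 3 * t b \<le> 23608 / 100000 * (54 / 100)"
        using b phi_power_bounds by (intro mult_mono; linarith)+
      have m0: "0 \<le> phi ^ 3 * t b" using t_nonneg by simp
      have A2: "A (b + 2)"
      proof (rule ccontr)
        assume "\<not> A (b + 2)"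
        then show False using t_lower[of "b + 2"] block_1(1)[of b] b m unfolding t_def by simp
      qed
      have A3: "\<not> A (b + 3)"
      proof
        assume "A (b + 3)"
        then have A4: "\<not> A (b + 4)" using blocks b A2 by blast
        then show False
          using t_upper[of "b + 4"] block_3(1)[of b] b A2 \<open>A (b + 3)\<close> m phi_bounds unfolding t_def by simp
      qed
      show ?thesis
        using block_2(1)[OF b(2) A2 A3] A2 A3 m m0 phi_power_bounds(1,2) unfolding t_def by simp
    qed
    have k: "\<not> A (b + 3 * k) \<and> 38 / 100 \<le> t (b + 3 * k) \<and> t (b + 3 * k) \<le> 54 / 100" for k
    proof (induction k)
      case (Suc k)
      then show ?case using step[of "b + 3 * k"] b by (simp add: add_ac)
    qed (use b in auto)
    \<comment> \<open>The subtracted value is the fixed point of \<open>block_2(2)\<close>.\<close>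
    define f where "f k = w (b + 3 * k) - phi ^ 2 / (1 + phi ^ 3)" for k
    have "f 0 = 0"
    proof (rule contraction_imp_zero[of "phi ^ 3" f])
      show "\<bar>f k\<bar> \<le> phi ^ 3 * \<bar>f (Suc k)\<bar>" for k
      proof -
        have e: "w (b + 3 * k) = phi ^ 2 - phi ^ 3 * w (b + 3 * Suc k)"
          using block_2(2)[of "b + 3 * k"] k[of k] step[of "b + 3 * k"] b by (simp add: add_ac)
        have "1 + phi ^ 3 > 0" using phi_power_bounds(3) by linarith
        then have "f k = - (phi ^ 3) * f (Suc k)" unfolding f_def e by (simp add: field_simps)
        then show ?thesis by (simp add: abs_mult)
      qed
      show "\<bar>f k\<bar> \<le> 1 + \<bar>phi ^ 2 / (1 + phi ^ 3)\<bar>" for k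
        unfolding f_def using w_le_1[of "b + 3 * k"] by (intro order_trans[OF abs_triangle_ineq4]) simp
    qed (use phi_power_bounds in auto)
    then have "w b = phi ^ 2 / (1 + phi ^ 3)" by (simp add: f_def)
    then show ?thesis by blast
  next
    case no_mid: False
    have no_block_2: "\<not> A (b + 2) \<or> A (b + 2) \<and> A (b + 3) \<and> \<not> A (b + 4)" if b: "b \<ge> N" "\<not> A b" for b
    proof (rule ccontr)
      assume "\<not> ?thesis"
      then have "A (b + 2)" "\<not> A (b + 3)" using blocks[OF b] by blast+
      then have "t (b + 3) = phi ^ 3 * t b + phi ^ 2" "\<not> A (b + 3)"
        using block_2(1) b unfolding t_def by blast+
      moreover have "0 \<le> phi ^ 3 * t b \<and> phi ^ 3 * t b \<le> 23608 / 100000 * (66 / 100)"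
        using mult_bounds[OF b _ phi_power_bounds(3,4)] t_nonneg[of b] by simp
      ultimately have "38 / 100 \<le> t (b + 3)" "t (b + 3) \<le> 54 / 100"
        using phi_power_bounds(1,2) by linarith+
      then show False using no_mid \<open>\<not> A (b + 3)\<close> b(1) trans_le_add1 by blast
    qed
    \<comment> \<open>With length 3 excluded, a block of length 4 ends with weight at least
      \<open>phi\<close> and one of length 2 with weight below 0.26. Repeating length 4 would exceed
      0.66 and repeating length 2 would fall below 0.24, so the two alternate.\<close>
    have high: "t (b + 4) \<ge> 618 / 1000" if "\<not> A b" "A (b + 2)" "A (b + 3)" "\<not> A (b + 4)" for b
    proof -
      have "0 \<le> phi ^ 4 * t b" using t_nonneg by simp
      then show ?thesis using block_3(1)[OF that] phi_bounds unfolding t_def by linarith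
    qed
    have low: "t (b + 2) < 26 / 100" if "b \<ge> N" "\<not> A b" "\<not> A (b + 2)" for b
    proof -
      have "phi ^ 2 * t b \<le> 38197 / 100000 * (66 / 100)"
        using mult_bounds[OF that(1,2) _ phi_power_bounds(1,2)] by simp
      then show ?thesis using block_1(1)[OF that(2,3)] unfolding t_def by linarith
    qed
    have from_low: "A (b + 2) \<and> A (b + 3) \<and> \<not> A (b + 4) \<and> t (b + 4) \<ge> 618 / 1000"
      if b: "b \<ge> N" "\<not> A b" "t b < 26 / 100" for b
    proof -
      have "A (b + 2)"
      proof (rule ccontr)
        assume "\<not> A (b + 2)"
        moreover have "phi ^ 2 * t b \<le> 38197 / 100000 * (26 / 100)"
          using b t_nonneg[of b] phi_power_bounds by (intro mult_mono; linarith)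
        ultimately show False using t_lower[of "b + 2"] block_1(1)[of b] b unfolding t_def by simp
      qed
      then show ?thesis using no_block_2[OF b(1,2)] high b by blast
    qed
    have from_high: "\<not> A (b + 2)" if b: "b \<ge> N" "\<not> A b" "t b \<ge> 618 / 1000" for b
    proof
      assume "A (b + 2)"
      then have A34: "A (b + 2)" "A (b + 3)" "\<not> A (b + 4)" using no_block_2[OF b(1,2)] by blast+
      have "14588 / 100000 * (618 / 1000) \<le> phi ^ 4 * t b" using b phi_power_bounds by (intro mult_mono; linarith)
      then show False using t_upper[of "b + 4"] block_3(1)[OF b(2) A34] b A34 phi_bounds unfolding t_def by simp
    qed
    have cycle: "\<not> A (b + 2) \<and> A (b + 4) \<and> A (b + 5) \<and> \<not> A (b + 6) \<and> t (b + 6) \<ge> 618 / 1000"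
      if b: "b \<ge> N" "\<not> A b" "t b \<ge> 618 / 1000" for b
    proof -
      have "b + 2 + 2 = b + 4" "b + 2 + 3 = b + 5" "b + 2 + 4 = b + 6" by simp_all
      then show ?thesis
        using from_high[OF b] low[OF b(1,2)] from_low[of "b + 2"] b(1) by (metis trans_le_add1)
    qed
    obtain b0 where b0: "b0 \<ge> N" "\<not> A b0" using often by blast
    obtain b where b: "b \<ge> N" "\<not> A b" "t b \<ge> 618 / 1000"
    proof (cases "A (b0 + 2)")
      case True
      then show ?thesis using that[of "b0 + 4"] no_block_2[OF b0] high[OF b0(2)] b0(1) by auto
    next
      case False
      then show ?thesis
        using that[of "b0 + 2 + 4"] from_low[of "b0 + 2"] low[OF b0 False] b0(1) by auto
    qed
    have k: "\<not> A (b + 6 * k) \<and> t (b + 6 * k) \<ge> 618 / 1000" for k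
    proof (induction k)
      case (Suc k)
      then show ?case using cycle[of "b + 6 * k"] b by (simp add: add_ac)
    qed (use b in auto)
    define f where "f k = w (b + 6 * k) - phi ^ 6 / (1 - phi ^ 6)" for k
    have "f 0 = 0"
    proof (rule contraction_imp_zero[of "phi ^ 6" f])
      show "\<bar>f k\<bar> \<le> phi ^ 6 * \<bar>f (Suc k)\<bar>" for k
      proof -
        define b' where "b' = b + 6 * k"
        have b': "\<not> A b'" "\<not> A (b' + 2)" "A (b' + 2 + 2)" "A (b' + 2 + 3)" "\<not> A (b' + 2 + 4)"
        proof -
          have sums: "b' + 2 + 2 = b' + 4" "b' + 2 + 3 = b' + 5" "b' + 2 + 4 = b' + 6" by simp_all
          have "\<not> A b'" "t b' \<ge> 618 / 1000" "b' \<ge> N" using k[of k] b by (simp_all add: b'_def)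
          then show "\<not> A b'" "\<not> A (b' + 2)" "A (b' + 2 + 2)" "A (b' + 2 + 3)" "\<not> A (b' + 2 + 4)"
            unfolding sums using cycle[of b'] by blast+
        qed
        have "w b' = phi ^ 2 * (phi ^ 4 + phi ^ 4 * w (b' + 2 + 4))"
          using block_1(2)[OF b'(1,2)] block_3(2)[OF b'(2-5)] by simp
        then have e: "w (b + 6 * k) = phi ^ 6 + phi ^ 6 * w (b + 6 * Suc k)"
          by (simp add: b'_def algebra_simps flip: power_add)
        have "1 - phi ^ 6 \<noteq> 0" using phi_power_bounds(8) by linarith
        then have "f k = phi ^ 6 * f (Suc k)" unfolding f_def e by (simp add: field_simps)
        then show ?thesis by (simp add: abs_mult)
      qed
      show "\<bar>f k\<bar> \<le> 1 + \<bar>phi ^ 6 / (1 - phi ^ 6)\<bar>" for k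
        unfolding f_def using w_le_1[of "b + 6 * k"] by (intro order_trans[OF abs_triangle_ineq4]) simp
    qed (use phi_power_bounds in auto)
    then have "w b = phi ^ 6 / (1 - phi ^ 6)" by (simp add: f_def)
    then show ?thesis by blast
  qed
qed

end

lemma countable_rep_eq:
  assumes "\<alpha> > 14395 / 10000"
  shows "countable {x. sturmian_word phi x \<and> rep x = ereal \<alpha>}"
proof (rule countable_if_eventually_fixed)
  show "countable {- (phi ^ 2), phi ^ 2 / (1 + phi ^ 3), phi ^ 6 / (1 - phi ^ 6)}" by simp
  fix y A w assume "generic_renormalization y A w" and rep: "rep (word y) = ereal \<alpha>"
  then interpret generic_renormalization y A w by simp
  have "\<forall>\<^sub>F i in sequentially. admits A (439 / 1000) i"
    \<comment> \<open>The passage from 0.4395 to 0.439 is the slack consumed by the limits.\<close>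
    by (rule eventually_admits[of "4395 / 10000"]) (use rep assms in auto)
  then show "\<exists>M. w M \<in> {- (phi ^ 2), phi ^ 2 / (1 + phi ^ 3), phi ^ 6 / (1 - phi ^ 6)}"
    by (rule eventually_fixed_point)
qed

subsection \<open>Two uncountable families of itineraries\<close>

lemma sparse_unique:
  fixes x y :: nat
  assumes "2 ^ (a + 3) + x = 2 ^ (b + 3) + y" "x < 8" "y < 8"
  shows "a = b \<and> x = y"
proof -
  have less: "2 ^ (a + 3) + x < 2 ^ (b + 3) + y" if "a < b" "x < 8" for a b x y :: nat
  proof -
    have "(2::nat) ^ (a + 4) \<le> 2 ^ (b + 3)" by (rule power_increasing) (use that in auto)
    moreover have "(8::nat) \<le> 2 ^ (a + 3)" using power_increasing[of 3 "a + 3" "2::nat"] by simp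
    moreover have "(2::nat) ^ (a + 4) = 2 ^ (a + 3) + 2 ^ (a + 3)" by (simp add: power_add)
    ultimately show ?thesis using that by linarith
  qed
  have "a = b" using less[of a b x y] less[of b a y x] assms by (metis linorder_neqE_nat less_irrefl)
  then show ?thesis using assms by simp
qed

lemma k_less_sparse: "k < 2 ^ (k + 3)"
  by (rule less_le_trans[OF less_exp]) simp

lemma linear_less_power: "2 \<le> k \<Longrightarrow> 2 * k + 6 < (2::nat) ^ (k + 2)"
  by (induction k rule: dec_induct) auto

lemma of_bool_less: "of_bool P < (2::nat)"
  by simp

text \<open>Membership of \<open>k\<close> in \<open>E\<close> moves one \<open>B\<close> by a
  single place, so \<open>E\<close> can be read off, while the growing gaps let the weight recover
  before each \<open>B\<close>.\<close>

definition sparse_failures :: "nat set \<Rightarrow> nat \<Rightarrow> bool" where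
  "sparse_failures E i \<longleftrightarrow> (\<forall>k. i \<noteq> 2 ^ (k + 3) + of_bool (k \<in> E))"

lemma not_sparse_failures:
  assumes "x < 8"
  shows "\<not> sparse_failures E (2 ^ (k + 3) + x) \<longleftrightarrow> x = of_bool (k \<in> E)"
proof
  assume "\<not> sparse_failures E (2 ^ (k + 3) + x)"
  then obtain k' where "2 ^ (k + 3) + x = 2 ^ (k' + 3) + of_bool (k' \<in> E)"
    unfolding sparse_failures_def by blast
  then have "k = k' \<and> x = of_bool (k' \<in> E)"
    by (rule sparse_unique) (use assms of_bool_less[of "k' \<in> E"] in linarith)+
  then show "x = of_bool (k \<in> E)" by simp
next
  assume "x = of_bool (k \<in> E)"
  then show "\<not> sparse_failures E (2 ^ (k + 3) + x)" unfolding sparse_failures_def by blast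
qed

text \<open>Along \<open>A\<close> the weight contracts towards \<open>1 + phi\<close>, the fixed
  point of \<open>t = phi * (t + 1)\<close>; the bound is the run started at weight 0.\<close>

lemma weight_run:
  assumes "\<And>j. i \<le> j \<Longrightarrow> j \<le> i + n \<Longrightarrow> A j"
  shows "weight A (i + n) \<ge> (1 + phi) * (1 - phi ^ n)"
  using assms
proof (induction n)
  case (Suc n)
  have "step_digit A (i + n) = 1" using Suc.prems by (simp add: step_digit_def)
  then have "weight A (i + Suc n) = phi * (weight A (i + n) + 1)" by simp
  also have "\<dots> \<ge> phi * ((1 + phi) * (1 - phi ^ n) + 1)"
    using Suc by (intro mult_left_mono) auto
  also have "phi * ((1 + phi) * (1 - phi ^ n) + 1) = (phi + phi * phi) * (1 - phi ^ n) + phi"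
    by (simp add: algebra_simps)
  also have "\<dots> = 1 + phi - phi ^ n" unfolding phi_square' by (simp add: algebra_simps)
  also have "phi ^ n = (phi + phi * phi) * phi ^ n" unfolding phi_square' by simp
  finally show ?case by (simp add: algebra_simps)
qed (simp add: weight_nonneg)

lemma weight_sparse_failures:
  "weight (sparse_failures E) (2 ^ (k + 3) + of_bool (k \<in> E)) \<ge> 1 - phi ^ k"
proof -
  define b where "b = 2 ^ (k + 3) + (of_bool (k \<in> E) :: nat)"
  \<comment> \<open>The places from \<open>i\<close> to \<open>b - 1\<close> are
    \<open>k + 1\<close> letters \<open>A\<close>, hence \<open>k\<close> digits 1; the previous
    \<open>B\<close> is at most at \<open>2 ^ (k + 2) + 1\<close>, well before
    \<open>i\<close>.\<close>
  define i where "i = b - 1 - k"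
  have kb: "k < b" using k_less_sparse[of k] by (simp add: b_def)
  then have b: "b = Suc (i + k)" by (simp add: i_def)
  have run: "sparse_failures E j" if "i \<le> j" "j \<le> i + k" for j
  proof (rule ccontr)
    assume "\<not> sparse_failures E j"
    then obtain k' where j: "j = 2 ^ (k' + 3) + of_bool (k' \<in> E)" unfolding sparse_failures_def by blast
    have "k' < k"
    proof (rule ccontr)
      assume "\<not> k' < k"
      moreover have "k' \<noteq> k" using j b that by (auto simp: b_def)
      ultimately have "(2::nat) ^ (k + 4) \<le> 2 ^ (k' + 3)" by (intro power_increasing) auto
      moreover have "(2::nat) ^ (k + 4) = 2 ^ (k + 3) + 2 ^ (k + 3)" by (simp add: power_add)
      moreover have "(1::nat) \<le> 2 ^ (k + 3)" by simp
      ultimately have "j \<ge> b" using j of_bool_less[of "k \<in> E"] unfolding b_def by linarith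
      then show False using that b by simp
    qed
    then have "(2::nat) ^ (k' + 3) \<le> 2 ^ (k + 2)" by (intro power_increasing) auto
    moreover have "k + 2 < (2::nat) ^ (k + 2)" by (rule less_exp)
    moreover have "(2::nat) ^ (k + 3) = 2 ^ (k + 2) + 2 ^ (k + 2)" by (simp add: power_add)
    ultimately have "j + k + 1 < b" using j of_bool_less[of "k' \<in> E"] unfolding b_def by linarith
    then show False using that b by simp
  qed
  have "step_digit (sparse_failures E) (i + k) = 0"
    using not_sparse_failures[of "of_bool (k \<in> E)" E k] b by (auto simp: step_digit_def b_def)
  then have "weight (sparse_failures E) b = phi * weight (sparse_failures E) (i + k)" by (simp add: b)
  also have "\<dots> \<ge> phi * ((1 + phi) * (1 - phi ^ k))"
    using weight_run[of i k, OF run] by (intro mult_left_mono) auto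
  also have "phi * ((1 + phi) * (1 - phi ^ k)) = (phi + phi * phi) * (1 - phi ^ k)"
    by (simp add: algebra_simps)
  also have "\<dots> = 1 - phi ^ k" unfolding phi_square' by simp
  finally show ?thesis by (simp add: b_def)
qed

lemma phi_square_times: "phi ^ 2 * (2 + phi) = 1"
  unfolding phi_square by (simp add: algebra_simps phi_square')

text \<open>The lower bound comes from \<open>0 \<le> weight\<close> and from
  \<open>weight_le_1\<close>, whatever the itinerary. Sparseness gives the upper bound: weights at
  the \<open>B\<close> approach 1, where \<open>1 / (weight + 1 + phi)\<close> becomes
  \<open>phi ^ 2\<close>.\<close>

lemma uncountable_mu_min: "uncountable {x. sturmian_word phi x \<and> rep x = ereal mu_min}"
proof (rule uncountable_if_family[where fam = sparse_failures])
  show "inj sparse_failures"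
  proof (rule injI)
    fix E E' assume eq: "sparse_failures E = sparse_failures E'"
    have "k \<in> E \<longleftrightarrow> k \<in> E'" for k
      using not_sparse_failures[of 1 E k] not_sparse_failures[of 1 E' k] eq
      by (cases "k \<in> E"; cases "k \<in> E'") simp_all
    then show "E = E'" by blast
  qed
  show "sparse_failures E (Suc i)" if fail: "\<not> sparse_failures E i" for E i
  proof -
    obtain k where i: "i = 2 ^ (k + 3) + of_bool (k \<in> E)" using fail unfolding sparse_failures_def by blast
    show ?thesis
      using not_sparse_failures[of "of_bool (k \<in> E) + 1" E k] of_bool_less[of "k \<in> E"] unfolding i by auto
  qed
  show "\<exists>i\<ge>m. sparse_failures E i \<and> sparse_failures E (Suc i)" for E m
  proof -
    have "sparse_failures E (2 ^ (m + 3) + 2)" "sparse_failures E (2 ^ (m + 3) + 3)"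
      using not_sparse_failures[of 2 E m] not_sparse_failures[of 3 E m]
      by (cases "m \<in> E"; simp)+
    moreover have "2 ^ (m + 3) + 3 = Suc (2 ^ (m + 3) + 2)" "2 ^ (m + 3) + 2 \<ge> m"
      using k_less_sparse[of m] by simp_all
    ultimately show ?thesis by metis
  qed
  show "rep (word y) = ereal mu_min" if "generic_renormalization y (sparse_failures E) w" for y E w
  proof -
    interpret generic_renormalization y "sparse_failures E" w by fact
    let ?A = "sparse_failures E"
    show ?thesis unfolding mu_min_def
    proof (rule rep_eqI)
      show "phi ^ 2 \<le> phi" by (simp add: power2_eq_square)
      fix c' :: real assume c': "0 < c'" "c' < phi ^ 2"
      have "admits ?A c' i" for i
        unfolding admits_def
      proof (intro conjI impI)
        have le: "c' * (2 + phi) \<le> phi ^ 2 * (2 + phi)" using c' by (intro mult_right_mono) auto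
        then show "c' * (2 + phi) \<le> 1 + weight ?A i"
          using weight_nonneg[of ?A i] phi_square_times by linarith
        assume "\<not> ?A i"
        then have "c' * (weight ?A i + 1 + phi) \<le> c' * (2 + phi)"
          using weight_le_1 c' by (intro mult_left_mono) auto
        then show "c' * (weight ?A i + 1 + phi) \<le> 1" using le phi_square_times by linarith
      qed
      then show "\<forall>\<^sub>F i in sequentially. admits ?A c' i" by simp
    next
      fix c' assume c': "phi ^ 2 < c'"
      then have cpos: "c' > 0" by (meson less_trans phi_pos zero_less_power)
      have "phi ^ 2 * (2 + phi) < c' * (2 + phi)" using c' by (intro mult_strict_right_mono) (auto intro: add_pos_pos)
      then have pos: "0 < (c' * (2 + phi) - 1) / c'" using phi_square_times cpos by simp
      have "\<forall>\<^sub>F k in sequentially. phi ^ k < (c' * (2 + phi) - 1) / c'"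
        by (rule order_tendstoD(2)[OF phi_power_tendsto pos])
      then obtain K where K: "\<And>k. k \<ge> K \<Longrightarrow> phi ^ k < (c' * (2 + phi) - 1) / c'"
        unfolding eventually_sequentially by blast
      show "\<exists>\<^sub>F i in sequentially. \<not> admits ?A c' i"
        unfolding frequently_sequentially
      proof
        fix M
        define k where "k = max K M"
        define b where "b = 2 ^ (k + 3) + (of_bool (k \<in> E) :: nat)"
        have "b \<ge> M" using k_less_sparse[of k] by (simp add: b_def k_def)
        have "c' * phi ^ k < c' * (2 + phi) - 1"
          using K[of k] cpos by (simp add: k_def pos_less_divide_eq mult.commute)
        moreover have "c' * (1 - phi ^ k + 1 + phi) \<le> c' * (weight ?A b + 1 + phi)"
          using weight_sparse_failures[of k E] cpos by (intro mult_left_mono) (auto simp: b_def)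
        ultimately have "1 < c' * (weight ?A b + 1 + phi)" by (simp add: algebra_simps)
        moreover have "\<not> ?A b" using not_sparse_failures[of "of_bool (k \<in> E)" E k] by (simp add: b_def)
        ultimately show "\<exists>i\<ge>M. \<not> admits ?A c' i" using \<open>b \<ge> M\<close> unfolding admits_def by force
      qed
    qed simp
  qed
qed

text \<open>
  The marked triples are \<open>BAB\<close>, a triple before a marked one is \<open>AAA\<close> and the remaining ones are
  \<open>AAB\<close>. After \<open>BAB\<close>, the alternation of \<open>AAA\<close> and \<open>BAB\<close> is interrupted by one triple \<open>AAB\<close> where \<open>P\<close>
  holds. As \<open>AAB\<close> is possible only directly after \<open>BAB\<close>, two consecutive positions in \<open>P\<close> produce
  exactly one \<open>AAB\<close>.
\<close>
fun mark :: "(nat \<Rightarrow> bool) \<Rightarrow> nat \<Rightarrow> bool" where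
  "mark P 0 = True"
| "mark P (Suc 0) = False"
| "mark P (Suc (Suc r)) = (\<not> mark P (Suc r) \<and> \<not> (mark P r \<and> P (Suc r)))"

definition triples :: "(nat \<Rightarrow> bool) \<Rightarrow> nat \<Rightarrow> bool" where
  "triples m i = (if i mod 3 = 0 then \<not> m (i div 3) else i mod 3 = 1 \<or> m (Suc (i div 3)))"

section \<open>Weights along triples, and insertions of \<open>AAB\<close>\<close>

lemma triples_simps:
  "triples m (3 * r) \<longleftrightarrow> \<not> m r" "triples m (Suc (3 * r))" "triples m (Suc (Suc (3 * r))) \<longleftrightarrow> m (Suc r)"
  "triples m (Suc (Suc (Suc (3 * r)))) \<longleftrightarrow> \<not> m (Suc r)"
proof -
  have "Suc (Suc (3 * r)) mod 3 = 2" "Suc (Suc (3 * r)) div 3 = r" "Suc (3 * r) mod 3 = 1"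
    by presburger+
  then show "triples m (3 * r) \<longleftrightarrow> \<not> m r" "triples m (Suc (3 * r))" "triples m (Suc (Suc (3 * r))) \<longleftrightarrow> m (Suc r)"
    by (simp_all add: triples_def)
  have "Suc (Suc (Suc (3 * r))) = 3 * Suc r" by simp
  then show "triples m (Suc (Suc (Suc (3 * r)))) \<longleftrightarrow> \<not> m (Suc r)" by (simp add: triples_def)
qed

lemma triple_cases:
  fixes i :: nat
  obtains r where "i = 3 * r" | r where "i = Suc (3 * r)" | r where "i = Suc (Suc (3 * r))"
proof -
  have "i = 3 * (i div 3) \<or> i = Suc (3 * (i div 3)) \<or> i = Suc (Suc (3 * (i div 3)))" by presburger
  then show ?thesis using that by blast
qed

context
  fixes P :: "nat \<Rightarrow> bool"
begin

private abbreviation "m \<equiv> mark P"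
private abbreviation "A \<equiv> triples (mark P)"
private abbreviation "\<theta> r \<equiv> weight (triples (mark P)) (3 * r)"

lemma mark_isolated: "m r \<Longrightarrow> \<not> m (Suc r)"
  by (cases r) auto

lemma defect_imp: "\<not> m r \<Longrightarrow> \<not> m (Suc r) \<Longrightarrow> \<exists>r'. r = Suc r' \<and> m r' \<and> P r"
  by (cases r) auto

lemma after_defect: "\<not> m r \<Longrightarrow> \<not> m (Suc r) \<Longrightarrow> m (Suc (Suc r))"
  by simp

lemma triples_not: "\<not> A i \<Longrightarrow> A (Suc i)"
  by (cases i rule: triple_cases) (use mark_isolated in \<open>auto simp: triples_simps\<close>)

lemma triples_often: "\<exists>i\<ge>n. A i \<and> A (Suc i)"
proof -
  obtain r where "r \<ge> n" "\<not> m r" using mark_isolated[of n] by (metis le_SucI le_refl)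
  then show ?thesis by (intro exI[of _ "3 * r"]) (auto simp: triples_simps)
qed

lemma digits:
  "step_digit A (3 * r) = of_bool (\<not> m r)" "step_digit A (Suc (3 * r)) = of_bool (m (Suc r))"
  "step_digit A (Suc (Suc (3 * r))) = 0"
  by (simp_all add: step_digit_def triples_simps)

lemma weight_triple:
  "weight A (Suc (3 * r)) = phi * (\<theta> r + of_bool (\<not> m r))"
  "weight A (Suc (Suc (3 * r))) = phi ^ 2 * (\<theta> r + of_bool (\<not> m r)) + phi * of_bool (m (Suc r))"
  "\<theta> (Suc r) = phi ^ 3 * (\<theta> r + of_bool (\<not> m r)) + phi ^ 2 * of_bool (m (Suc r))"
proof -
  show 1: "weight A (Suc (3 * r)) = phi * (\<theta> r + of_bool (\<not> m r))" by (simp add: digits)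
  show 2: "weight A (Suc (Suc (3 * r))) = phi ^ 2 * (\<theta> r + of_bool (\<not> m r)) + phi * of_bool (m (Suc r))"
    by (simp only: weight.simps(2)[of _ "Suc (3 * r)"] digits 1) (simp add: power2_eq_square algebra_simps)
  have "3 * Suc r = Suc (Suc (Suc (3 * r)))" by simp
  then show "\<theta> (Suc r) = phi ^ 3 * (\<theta> r + of_bool (\<not> m r)) + phi ^ 2 * of_bool (m (Suc r))"
    by (simp only: weight.simps(2)[of _ "Suc (Suc (3 * r))"] digits 2)
      (simp add: power2_eq_square power3_eq_cube algebra_simps)
qed

lemma theta_mark: "m r \<Longrightarrow> \<theta> (Suc r) = phi ^ 3 * \<theta> r"
  using mark_isolated[of r] unfolding weight_triple(3) by simp

lemma theta_before_mark: "m (Suc r) \<Longrightarrow> \<theta> (Suc r) = phi ^ 3 * \<theta> r + phi"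
proof -
  assume "m (Suc r)"
  moreover have "\<not> m r" using mark_isolated[of r] \<open>m (Suc r)\<close> by blast
  ultimately have "\<theta> (Suc r) = phi ^ 3 * (\<theta> r + 1) + phi ^ 2" unfolding weight_triple(3) by simp
  moreover have "phi ^ 3 + phi ^ 2 = phi" by (simp add: phi_powers phi_square)
  ultimately show ?thesis unfolding distrib_left by linarith
qed

lemma theta_defect: "\<not> m r \<Longrightarrow> \<not> m (Suc r) \<Longrightarrow> \<theta> (Suc r) = phi ^ 3 * (\<theta> r + 1)"
  unfolding weight_triple(3) by simp

lemma theta_le_1: "m r \<Longrightarrow> \<theta> r \<le> 1"
  by (rule weight_le_1) (simp add: triples_simps)

lemma fixed_point_bounds: "0 \<le> phi ^ 4 / (1 - phi ^ 6)" "phi ^ 4 / (1 - phi ^ 6) \<le> 1"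
  using phi_power_bounds by (auto simp: divide_le_eq_1)

text \<open>Going back two triples at a time, an undisturbed alternation applies \<open>x\<close> to
  \<open>phi ^ 6 * x + phi ^ 4\<close>, whose fixed point is \<open>phi ^ 4 / (1 - phi ^ 6)\<close>.
  The factor 2 bounds the initial distance.\<close>

lemma theta_converges:
  assumes "m r" "2 * g \<le> r" "\<And>q. r \<le> q + 2 * g \<Longrightarrow> q < r \<Longrightarrow> \<not> P q"
  shows "\<bar>\<theta> (Suc r) - phi ^ 4 / (1 - phi ^ 6)\<bar> \<le> 2 * (phi ^ 6) ^ g"
  using assms
proof (induction g arbitrary: r)
  case 0
  have "phi < 1" by simp
  then show ?case using weight_nonneg[of A "3 * Suc r"] weight_le[of A "3 * Suc r"] fixed_point_bounds
    by (simp only: power_0 mult_1_right abs_le_iff) linarith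
next
  case (Suc g)
  define p where "p = phi ^ 4 / (1 - phi ^ 6)"
  have p: "p = phi ^ 6 * p + phi ^ 4"
  proof -
    have "1 - phi ^ 6 \<noteq> 0" using phi_power_bounds(8) by linarith
    then show ?thesis by (simp add: p_def field_simps)
  qed
  have "2 \<le> r" using Suc.prems(2) by simp
  then obtain r' where r': "r = Suc (Suc r')" by (metis add_2_eq_Suc le_Suc_ex)
  have not: "\<not> m (Suc r')" using Suc.prems(1) unfolding r' by simp
  have "m r'"
  proof (rule ccontr)
    assume "\<not> m r'"
    then have "P r'" using defect_imp not by blast
    then show False using Suc.prems(3)[of r'] r' by simp
  qed
  have IH: "\<bar>\<theta> (Suc r') - p\<bar> \<le> 2 * (phi ^ 6) ^ g"
    unfolding p_def
  proof (rule Suc.IH)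
    show "2 * g \<le> r'" using Suc.prems(2) r' by simp
    show "\<not> P q" if "r' \<le> q + 2 * g" "q < r'" for q
      using Suc.prems(3)[of q] that r' by simp
  qed fact
  have "\<theta> (Suc r) = phi ^ 3 * (phi ^ 3 * \<theta> (Suc r') + phi)"
    using theta_mark[OF Suc.prems(1)] theta_before_mark[of "Suc r'"] Suc.prems(1) unfolding r' by metis
  also have "\<dots> = phi ^ 6 * \<theta> (Suc r') + phi ^ 4"
    by (simp add: algebra_simps eval_nat_numeral)
  finally have "\<theta> (Suc r) - p = phi ^ 6 * (\<theta> (Suc r') - p)"
    unfolding right_diff_distrib using p by linarith
  then have "\<bar>\<theta> (Suc r) - p\<bar> = phi ^ 6 * \<bar>\<theta> (Suc r') - p\<bar>" by (simp add: abs_mult)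
  also have "\<dots> \<le> phi ^ 6 * (2 * (phi ^ 6) ^ g)" using IH by (intro mult_left_mono) auto
  finally show ?case by (simp add: p_def mult_ac)
qed

end

text \<open>Two adjacent places are offered because the parity of the alternation on arrival is not
  known in advance. The shift by 4 keeps the pair for \<open>k\<close> in \<open>E\<close> disjoint
  from the pair for \<open>k\<close> outside \<open>E\<close>, so the place of the inserted triple
  reveals the bit.\<close>

definition defect_slot :: "nat set \<Rightarrow> nat \<Rightarrow> bool" where
  "defect_slot E r \<longleftrightarrow> (\<exists>k. r = 2 ^ (k + 3) + 4 * of_bool (k \<in> E) \<or> r = 2 ^ (k + 3) + 4 * of_bool (k \<in> E) + 1)"

lemma defect_slot_iff:
  assumes "x < 8"
  shows "defect_slot E (2 ^ (k + 3) + x) \<longleftrightarrow> x = 4 * of_bool (k \<in> E) \<or> x = 4 * of_bool (k \<in> E) + 1"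
proof
  assume "defect_slot E (2 ^ (k + 3) + x)"
  then obtain k' z where k': "2 ^ (k + 3) + x = 2 ^ (k' + 3) + (4 * of_bool (k' \<in> E) + z)" "z = 0 \<or> z = 1"
    unfolding defect_slot_def by (metis add.assoc add_0_right)
  have "k = k' \<and> x = 4 * of_bool (k' \<in> E) + z"
    by (rule sparse_unique[OF k'(1) assms]) (use k'(2) of_bool_less[of "k' \<in> E"] in auto)
  then show "x = 4 * of_bool (k \<in> E) \<or> x = 4 * of_bool (k \<in> E) + 1" using k'(2) by auto
next
  assume "x = 4 * of_bool (k \<in> E) \<or> x = 4 * of_bool (k \<in> E) + 1"
  then show "defect_slot E (2 ^ (k + 3) + x)" unfolding defect_slot_def by (auto simp: add.assoc)
qed

abbreviation defect :: "nat set \<Rightarrow> nat \<Rightarrow> bool" where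
  "defect E r \<equiv> \<not> mark (defect_slot E) r \<and> \<not> mark (defect_slot E) (Suc r)"

text \<open>If the triple before the slot is marked, the first place becomes the defect. Otherwise
  the first place is marked, since nothing disturbs the alternation before it, and the second place
  becomes the defect.\<close>

lemma defect_exists:
  "\<exists>x<2. defect E (2 ^ (k + 3) + 4 * of_bool (k \<in> E) + x)"
proof -
  define p where "p = 2 ^ (k + 3) + 4 * (of_bool (k \<in> E) :: nat)"
  let ?m = "mark (defect_slot E)"
  have P: "defect_slot E p" "defect_slot E (p + 1)" unfolding defect_slot_def p_def by blast+
  have "p > 0" by (simp add: p_def)
  then obtain q where q: "p = Suc q" by (cases p) auto
  have nq: "\<not> defect_slot E q"
  proof
    assume "defect_slot E q"
    then obtain k' z where k': "q = 2 ^ (k' + 3) + (4 * of_bool (k' \<in> E) + z)" "z = 0 \<or> z = 1"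
      unfolding defect_slot_def by (metis add.assoc add_0_right)
    have "2 ^ (k + 3) + 4 * of_bool (k \<in> E) = 2 ^ (k' + 3) + (4 * of_bool (k' \<in> E) + z + 1)"
      using k' q unfolding p_def by simp
    then have "k = k' \<and> 4 * of_bool (k \<in> E) = 4 * of_bool (k' \<in> E) + z + 1"
      by (rule sparse_unique) (use k'(2) of_bool_less[of "k' \<in> E"] of_bool_less[of "k \<in> E"] in auto)
    then have "k = k'" "4 * of_bool (k \<in> E) = 4 * of_bool (k' \<in> E) + z + 1" by blast+
    then show False by simp
  qed
  show ?thesis
  proof (cases "?m q")
    case True
    then have "defect E (p + 0)" using P(1) mark_isolated[of _ q] unfolding q by simp
    moreover have "(0::nat) < 2" by simp
    ultimately show ?thesis unfolding p_def by blast
  next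
    case False
    then have "?m p" using defect_imp[of "defect_slot E" q] nq unfolding q by blast
    then have "defect E (p + 1)" using P(2) mark_isolated[of _ p] by simp
    moreover have "(1::nat) < 2" by simp
    ultimately show ?thesis unfolding p_def by blast
  qed
qed

text \<open>The preceding slot belongs to a smaller power of 2 and is more than \<open>2 * k\<close>
  triples away, so the alternation has brought the weight within \<open>2 * (phi ^ 6) ^ k\<close> of
  its fixed point.\<close>

lemma theta_at_defect:
  assumes "\<epsilon> > 0"
  shows "\<exists>R. \<forall>r\<ge>R. defect E r \<longrightarrow>
    \<bar>weight (triples (mark (defect_slot E))) (3 * r) - phi ^ 4 / (1 - phi ^ 6)\<bar> < \<epsilon>"
proof -
  have "(\<lambda>k. 2 * (phi ^ 6) ^ k) \<longlonglongrightarrow> 2 * 0"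
    by (intro tendsto_mult tendsto_const LIMSEQ_power_zero) (use phi_power_bounds in simp)
  then have "\<forall>\<^sub>F k in sequentially. 2 * (phi ^ 6) ^ k < \<epsilon>" using assms by (intro order_tendstoD) auto
  then obtain K where K: "\<And>k. k \<ge> K \<Longrightarrow> 2 * (phi ^ 6) ^ k < \<epsilon>" unfolding eventually_sequentially by blast
  show ?thesis
  proof (intro exI[of _ "2 ^ (max K 2 + 4)"] allI impI)
    fix r :: nat assume r: "2 ^ (max K 2 + 4) \<le> r" and def: "defect E r"
    obtain r' where r': "r = Suc r'" "mark (defect_slot E) r'" and P: "defect_slot E r"
      using defect_imp def by blast
    obtain k where k: "r = 2 ^ (k + 3) + 4 * of_bool (k \<in> E) \<or> r = 2 ^ (k + 3) + 4 * of_bool (k \<in> E) + 1"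
      using P unfolding defect_slot_def by blast
    have "(8::nat) \<le> 2 ^ (k + 3)" using power_increasing[of 3 "k + 3" "2::nat"] by simp
    moreover have "(2::nat) ^ (k + 4) = 2 ^ (k + 3) + 2 ^ (k + 3)" by (simp add: power_add)
    ultimately have "r < 2 ^ (k + 4)" using k of_bool_less[of "k \<in> E"] by linarith
    then have "(2::nat) ^ (max K 2 + 4) < 2 ^ (k + 4)" using r by linarith
    then have "max K 2 + 4 < k + 4" by (simp only: power_strict_increasing_iff)
    then have kK: "k \<ge> K" "k \<ge> 2" by auto
    have big: "2 * k + 6 < (2::nat) ^ (k + 2)" using linear_less_power kK by simp
    have dbl: "(2::nat) ^ (k + 3) = 2 ^ (k + 2) + 2 ^ (k + 2)" by (simp add: power_add)
    have "\<bar>weight (triples (mark (defect_slot E))) (3 * Suc r') - phi ^ 4 / (1 - phi ^ 6)\<bar>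
        \<le> 2 * (phi ^ 6) ^ k"
    proof (rule theta_converges[OF r'(2)])
      show "2 * k \<le> r'" using k big dbl r'(1) by linarith
      fix q assume q: "r' \<le> q + 2 * k" "q < r'"
      show "\<not> defect_slot E q"
      proof
        assume "defect_slot E q"
        then obtain k' where k': "q = 2 ^ (k' + 3) + 4 * of_bool (k' \<in> E)
            \<or> q = 2 ^ (k' + 3) + 4 * of_bool (k' \<in> E) + 1"
          unfolding defect_slot_def by blast
        consider "k' = k" | "k' < k" | "k' > k" by linarith
        then show False
        proof cases
          case 1
          then show False using k k' q(2) r'(1) by auto
        next
          case 2
          then have "(2::nat) ^ (k' + 3) \<le> 2 ^ (k + 2)" by (intro power_increasing) auto
          then show False using k' of_bool_less[of "k' \<in> E"] k q(1) r'(1) big dbl by linarith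
        next
          case 3
          then have "(2::nat) ^ (k + 4) \<le> 2 ^ (k' + 3)" by (intro power_increasing) auto
          then show False using k' q(2) r'(1) \<open>r < 2 ^ (k + 4)\<close> by linarith
        qed
      qed
    qed
    then show "\<bar>weight (triples (mark (defect_slot E))) (3 * r) - phi ^ 4 / (1 - phi ^ 6)\<bar> < \<epsilon>"
      using K[OF kK(1)] r'(1) by simp
  qed
qed

text \<open>The summand \<open>phi + phi ^ 6 * (phi ^ 4 / (1 - phi ^ 6) + 1)\<close> is the limiting
  weight at the marked triple two places after a defect. Both fractions reduce to
  \<open>(8 * phi - 4) / (65 * phi - 38)\<close>.\<close>

lemma mu_4_eq: "mu_4 = 1 + 1 / (phi + phi ^ 6 * (phi ^ 4 / (1 - phi ^ 6) + 1) + 1 + phi)"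
proof -
  define D where "D = 8 * phi - 4"
  have D: "D > 0" using phi_bounds unfolding D_def by linarith
  have D6: "1 - phi ^ 6 = D" by (simp add: phi_powers D_def)
  have "phi + phi ^ 6 * (phi ^ 4 / D + 1) + 1 + phi
      = ((1 + 2 * phi + phi ^ 6) * D + phi ^ 6 * phi ^ 4) / D"
    using D by (simp add: field_simps)
  also have "(1 + 2 * phi + phi ^ 6) * D + phi ^ 6 * phi ^ 4 = 65 * phi - 38"
    unfolding phi_powers D_def by (simp add: algebra_simps phi_square')
  finally have "1 / (phi + phi ^ 6 * (phi ^ 4 / (1 - phi ^ 6) + 1) + 1 + phi) = D / (65 * phi - 38)"
    by (simp add: D6)
  moreover have "1 + 2 * phi - 2 * phi ^ 7 + phi ^ 11 = 65 * phi - 38" by (simp add: phi_powers)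
  ultimately show ?thesis unfolding mu_4_def by (simp add: D6)
qed

lemma uncountable_mu_4: "uncountable {x. sturmian_word phi x \<and> rep x = ereal mu_4}"
proof (rule uncountable_if_family[where fam = "\<lambda>E. triples (mark (defect_slot E))"])
  show "inj (\<lambda>E. triples (mark (defect_slot E)))"
  proof (rule injI)
    fix E E' assume eq: "triples (mark (defect_slot E)) = triples (mark (defect_slot E'))"
    have m_eq: "mark (defect_slot E) = mark (defect_slot E')"
    proof
      fix r show "mark (defect_slot E) r = mark (defect_slot E') r"
        using triples_simps(1)[of "mark (defect_slot E)" r] triples_simps(1)[of "mark (defect_slot E')" r] eq
        by simp
    qed
    have "4 * of_bool (k \<in> E) = (4 * of_bool (k \<in> E') :: nat)" for k
    proof -
      obtain x :: nat where x: "x < 2" "defect E (2 ^ (k + 3) + 4 * of_bool (k \<in> E) + x)"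
        using defect_exists by blast
      then have "defect E' (2 ^ (k + 3) + (4 * of_bool (k \<in> E) + x))" by (simp add: m_eq add.assoc)
      then have "defect_slot E' (2 ^ (k + 3) + (4 * of_bool (k \<in> E) + x))" using defect_imp by blast
      moreover have "4 * of_bool (k \<in> E) + x < 8" using x(1) by (simp add: of_bool_def)
      ultimately have "4 * of_bool (k \<in> E) + x = 4 * of_bool (k \<in> E') \<or>
          4 * of_bool (k \<in> E) + x = 4 * of_bool (k \<in> E') + 1"
        using defect_slot_iff by blast
      then show ?thesis using x(1) by (auto simp: of_bool_def split: if_splits)
    qed
    then have "k \<in> E \<longleftrightarrow> k \<in> E'" for k
      by (metis mult_cancel_left of_bool_eq_iff zero_neq_numeral)
    then show "E = E'" by blast
  qed
  show "\<exists>i\<ge>n. triples (mark (defect_slot E)) i \<and> triples (mark (defect_slot E)) (Suc i)" for E n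
    by (rule triples_often)
  show "rep (word y) = ereal mu_4" if "generic_renormalization y (triples (mark (defect_slot E))) w" for y E w
  proof -
    interpret generic_renormalization y "triples (mark (defect_slot E))" w by fact
    let ?m = "mark (defect_slot E)" and ?A = "triples (mark (defect_slot E))"
    define \<theta> where "\<theta> r = weight ?A (3 * r)" for r
    define p where "p = phi ^ 4 / (1 - phi ^ 6)"
    define \<sigma> where "\<sigma> = phi + phi ^ 6 * (p + 1)"
    define c where "c = 1 / (\<sigma> + 1 + phi)"
    have p: "0 \<le> p" "p \<le> 1" unfolding p_def by (rule fixed_point_bounds)+
    have "phi ^ 6 * 1 \<le> phi ^ 6 * (p + 1)" using p by (intro mult_left_mono) auto
    then have \<sigma>: "\<sigma> \<ge> phi + phi ^ 6" by (simp add: \<sigma>_def)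
    then have "\<sigma> + 1 + phi \<ge> 2290 / 1000" using phi_bounds phi_power_bounds by linarith
    then have c: "0 < c" "c \<le> 437 / 1000" unfolding c_def by (simp_all add: divide_le_eq)
    have inv: "1 / c = \<sigma> + 1 + phi" by (simp add: c_def)
    have \<theta>0: "\<theta> r \<ge> 0" for r unfolding \<theta>_def by (rule weight_nonneg)
    note \<theta>_mark = theta_mark[of "defect_slot E", folded \<theta>_def]
      and \<theta>_before_mark = theta_before_mark[of "defect_slot E", folded \<theta>_def]
      and \<theta>_defect = theta_defect[of "defect_slot E", folded \<theta>_def]
      and \<theta>_le_1 = theta_le_1[of "defect_slot E", folded \<theta>_def]
    have "rep (word y) = ereal (1 + c)"
    proof (rule rep_eqI)
      show "0 < c" "c \<le> phi" using c phi_bounds by linarith+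
      fix c' assume c': "0 < c'" "c' < c"
      define \<epsilon> where "\<epsilon> = 1 / c' - 1 / c"
      have "\<epsilon> > 0" using c' c unfolding \<epsilon>_def by (simp add: frac_less2)
      have B: "c' * (x + 1 + phi) \<le> 1" if "x \<le> \<sigma> + \<epsilon>" for x
      proof -
        have "x + 1 + phi \<le> 1 / c'" using that inv unfolding \<epsilon>_def by linarith
        then show ?thesis using c' by (simp add: pos_le_divide_eq mult.commute)
      qed
      \<comment> \<open>The constraint at \<open>AA\<close> is not sharp in this family:
        \<open>0.437 * (2 + phi)\<close> is about 1.1441, below \<open>1 + phi ^ 4\<close>, about
        1.1459.\<close>
      have AA: "c' * (2 + phi) \<le> 1 + x" if "x \<ge> phi ^ 4" for x
      proof -
        have "c' * (2 + phi) \<le> 437 / 1000 * (2 + phi)" using c c' by (intro mult_right_mono) auto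
        then show ?thesis using that phi_bounds phi_power_bounds(5) unfolding distrib_left by linarith
      qed
      obtain R where R: "\<And>r. r \<ge> R \<Longrightarrow> defect E r \<Longrightarrow> \<bar>\<theta> r - p\<bar> < \<epsilon>"
        using theta_at_defect[OF \<open>\<epsilon> > 0\<close>, of E] unfolding \<theta>_def p_def by blast
      have lower: "\<theta> r \<ge> phi ^ 4" if r2: "r \<ge> 2" and nr: "\<not> ?m r" for r
      proof -
        obtain q where q: "r = Suc (Suc q)" using r2 by (metis add_2_eq_Suc le_Suc_ex)
        show ?thesis
        proof (cases "?m (Suc q)")
          case True
          have "\<theta> (Suc q) \<ge> phi" using \<theta>_before_mark[OF True] \<theta>0[of q] by simp
          then have "phi ^ 3 * phi \<le> \<theta> r" using \<theta>_mark[OF True] q by (simp add: mult_left_mono)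
          then show ?thesis by (simp add: power3_eq_cube power4_eq_xxxx)
        next
          case False
          then have "\<theta> r = phi ^ 3 * (\<theta> (Suc q) + 1)" using \<theta>_defect nr q by simp
          moreover have "phi ^ 3 * 1 \<le> phi ^ 3 * (\<theta> (Suc q) + 1)" using \<theta>0 by (intro mult_left_mono) auto
          ultimately show ?thesis using phi_power_bounds by linarith
        qed
      qed
      \<comment> \<open>Only the marked triples that follow a defect at distance two can come close
        to \<open>\<sigma>\<close>; after an undisturbed alternation the weight is at most
        \<open>phi + phi ^ 6\<close>.\<close>
      have upper: "\<theta> r \<le> \<sigma> + \<epsilon>" if rR: "r \<ge> R + 2" and mr: "?m r" for r
      proof -
        have "2 \<le> r" using rR by simp
        then obtain q where q: "r = Suc (Suc q)" by (metis add_2_eq_Suc le_Suc_ex)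
        have n: "\<not> ?m (Suc q)" using mr q by simp
        have r: "\<theta> r = phi ^ 3 * \<theta> (Suc q) + phi" using \<theta>_before_mark mr q by simp
        show ?thesis
        proof (cases "?m q")
          case True
          then have "\<theta> r = phi ^ 3 * (phi ^ 3 * \<theta> q) + phi" using r \<theta>_mark by simp
          also have "\<dots> \<le> phi ^ 3 * (phi ^ 3 * 1) + phi"
            using \<theta>_le_1[OF True] by (intro add_right_mono mult_left_mono) auto
          also have "phi ^ 3 * (phi ^ 3 * 1) = phi ^ 6" by (simp flip: power_add)
          finally show ?thesis using \<sigma> \<open>\<epsilon> > 0\<close> by linarith
        next
          case False
          then have "\<theta> r = phi ^ 3 * (phi ^ 3 * (\<theta> q + 1)) + phi" using r \<theta>_defect n by simp
          also have "phi ^ 3 * (phi ^ 3 * (\<theta> q + 1)) = phi ^ 6 * (\<theta> q + 1)" by (simp add: eval_nat_numeral)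
          also have "\<theta> q \<le> p + \<epsilon>" using R[of q] False n rR q by (simp add: abs_less_iff)
          then have "phi ^ 6 * (\<theta> q + 1) + phi \<le> phi ^ 6 * (p + \<epsilon> + 1) + phi"
            by (intro add_right_mono mult_left_mono) auto
          also have "\<dots> = \<sigma> + phi ^ 6 * \<epsilon>" by (simp add: \<sigma>_def algebra_simps)
          also have "\<dots> \<le> \<sigma> + 1 * \<epsilon>"
            using \<open>\<epsilon> > 0\<close> phi_power_bounds by (intro add_left_mono mult_right_mono) auto
          finally show ?thesis by simp
        qed
      qed
      have "admits ?A c' i" if i: "i \<ge> 3 * (R + 2)" for i
      proof (cases i rule: triple_cases)
        case (1 r)
        then have "r \<ge> R + 2" using i by simp
        then show ?thesis using AA[OF lower[of r]] B[OF upper[of r]]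
          unfolding admits_def 1 triples_simps \<theta>_def by auto
      next
        case (2 r)
        have "c' * (2 + phi) \<le> 1 + weight ?A (Suc (3 * r))" if "?m (Suc r)"
        proof (rule AA)
          have "\<not> ?m r" using that mark_isolated by blast
          then have "weight ?A (Suc (3 * r)) = phi * (\<theta> r + 1)" by (simp only: weight_triple \<theta>_def) simp
          moreover have "phi * 1 \<le> phi * (\<theta> r + 1)" using \<theta>0 by (intro mult_left_mono) auto
          ultimately show "phi ^ 4 \<le> weight ?A (Suc (3 * r))" using phi_power_bounds phi_bounds by linarith
        qed
        then show ?thesis unfolding admits_def 2 by (simp add: triples_simps)
      next
        case (3 r)
        have "c' * (weight ?A (Suc (Suc (3 * r))) + 1 + phi) \<le> 1" if n: "\<not> ?m (Suc r)"
        proof (rule B)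
          have "\<theta> r + of_bool (\<not> ?m r) \<le> 1 + phi ^ 3"
          proof (cases "?m r")
            case True
            then show ?thesis using \<theta>_le_1[OF True] phi_power_bounds(3) by simp
          next
            case False
            obtain q where q: "r = Suc q" "?m q" using defect_imp False n by blast
            have "phi ^ 3 * \<theta> q \<le> phi ^ 3 * 1" using \<theta>_le_1[OF q(2)] by (intro mult_left_mono) auto
            then show ?thesis using \<theta>_mark[OF q(2)] False q by simp
          qed
          then have "phi ^ 2 * (\<theta> r + of_bool (\<not> ?m r)) \<le> phi ^ 2 * (1 + phi ^ 3)"
            by (intro mult_left_mono) auto
          moreover have "phi ^ 2 * (1 + phi ^ 3) \<le> phi"
          proof -
            have "phi ^ 2 * (1 + phi ^ 3) \<le> 38197 / 100000 * (123608 / 100000)"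
              using phi_power_bounds by (intro mult_mono; linarith)
            then show ?thesis using phi_bounds by linarith
          qed
          moreover have "weight ?A (Suc (Suc (3 * r))) = phi ^ 2 * (\<theta> r + of_bool (\<not> ?m r))"
            using n by (simp only: weight_triple \<theta>_def) simp
          ultimately show "weight ?A (Suc (Suc (3 * r))) \<le> \<sigma> + \<epsilon>"
            using \<sigma> \<open>\<epsilon> > 0\<close> phi_power_bounds(7) by linarith
        qed
        then show ?thesis unfolding admits_def 3 triples_simps by blast
      qed
      then show "\<forall>\<^sub>F i in sequentially. admits ?A c' i" unfolding eventually_sequentially by blast
    next
      fix c' assume c': "c < c'"
      define \<epsilon> where "\<epsilon> = 1 / c - 1 / c'"
      have cpos: "c' > 0" using c c' by linarith
      have "\<epsilon> > 0" using c' c unfolding \<epsilon>_def by (simp add: frac_less2)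
      obtain R where R: "\<And>r. r \<ge> R \<Longrightarrow> defect E r \<Longrightarrow> \<bar>\<theta> r - p\<bar> < \<epsilon>"
        using theta_at_defect[OF \<open>\<epsilon> > 0\<close>, of E] unfolding \<theta>_def p_def by blast
      show "\<exists>\<^sub>F i in sequentially. \<not> admits ?A c' i"
        unfolding frequently_sequentially
      proof
        fix M
        define k where "k = max R M"
        obtain x where "defect E (2 ^ (k + 3) + 4 * of_bool (k \<in> E) + x)" using defect_exists by blast
        then obtain r where r: "defect E r" "r \<ge> 2 ^ (k + 3)" by (metis add.assoc le_add1)
        have rM: "r \<ge> R" "r \<ge> M" using r(2) k_less_sparse[of k] by (auto simp: k_def)
        \<comment> \<open>The triple two places after a defect is marked, and its initial
          \<open>B\<close> carries a weight that tends to \<open>\<sigma>\<close>, so the bound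
          \<open>c\<close> is approached infinitely often.\<close>
        have m2: "?m (Suc (Suc r))" using after_defect r(1) by blast
        have "\<theta> (Suc (Suc r)) = phi ^ 3 * (phi ^ 3 * (\<theta> r + 1)) + phi"
          using \<theta>_before_mark[OF m2] \<theta>_defect r(1) by metis
        also have "phi ^ 3 * (phi ^ 3 * (\<theta> r + 1)) = phi ^ 6 * (\<theta> r + 1)" by (simp add: eval_nat_numeral)
        also have "\<theta> r > p - \<epsilon>" using R[OF rM(1) r(1)] by (simp add: abs_less_iff)
        then have "phi ^ 6 * (p - \<epsilon> + 1) + phi < phi ^ 6 * (\<theta> r + 1) + phi"
          by (intro add_strict_right_mono mult_strict_left_mono) auto
        moreover have "phi ^ 6 * (p - \<epsilon> + 1) + phi = \<sigma> - phi ^ 6 * \<epsilon>" by (simp add: \<sigma>_def algebra_simps)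
        moreover have "phi ^ 6 * \<epsilon> \<le> 1 * \<epsilon>"
          using \<open>\<epsilon> > 0\<close> phi_power_bounds by (intro mult_right_mono) auto
        ultimately have "\<theta> (Suc (Suc r)) + 1 + phi > 1 / c'" using inv \<epsilon>_def by linarith
        then have "c' * (\<theta> (Suc (Suc r)) + 1 + phi) > 1" using cpos by (simp add: pos_divide_less_eq mult.commute)
        moreover have "\<not> ?A (3 * Suc (Suc r))" unfolding triples_simps using m2 by blast
        ultimately have "\<not> admits ?A c' (3 * Suc (Suc r))" unfolding admits_def \<theta>_def by auto
        moreover have "3 * Suc (Suc r) \<ge> M" using rM by simp
        ultimately show "\<exists>i\<ge>M. \<not> admits ?A c' i" by blast
      qed
    qed
    moreover have "mu_4 = 1 + c" unfolding mu_4_eq c_def \<sigma>_def p_def ..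
    ultimately show ?thesis by simp
  qed
qed (rule triples_not)

theorem proposition1p6p1:
  shows "(\<forall>\<alpha>\<in>{mu_max, mu_2, mu_3}.
            countable {x. sturmian_word phi x \<and> rep x = ereal \<alpha>}) \<and>
         (\<forall>\<beta>\<in>{mu_4, mu_min}.
            uncountable {x. sturmian_word phi x \<and> rep x = ereal \<beta>})"
proof -
  have "mu_max > 14395 / 10000" unfolding mu_max_def using phi_bounds by linarith
  moreover have "mu_2 > 14395 / 10000" unfolding mu_2_def using phi_power_bounds by linarith
  moreover have "mu_3 > 14395 / 10000"
  proof -
    \<comment> \<open>\<open>mu_3\<close> exceeds the threshold by only about 0.0005, so the
      fraction is first reduced to \<open>(8 - 12 * phi) / (7 * phi - 3)\<close>.\<close>
    have "phi ^ 2 * (phi ^ 4 + phi ^ 2 + 1) = 4 - 8 * phi + 4 * (phi * phi)"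
      unfolding phi_powers phi_square by (simp add: algebra_simps)
    also have "\<dots> = 8 - 12 * phi" unfolding phi_square' by simp
    finally have "phi ^ 2 * (phi ^ 4 + phi ^ 2 + 1) = 8 - 12 * phi" .
    moreover have "phi ^ 5 + phi ^ 3 + 1 = 7 * phi - 3" by (simp add: phi_powers)
    moreover have "(8 - 12 * phi) / (7 * phi - 3) > 4395 / 10000"
      using phi_bounds by (simp add: less_divide_eq)
    ultimately have "4395 / 10000 < phi ^ 2 * (phi ^ 4 + phi ^ 2 + 1) / (phi ^ 5 + phi ^ 3 + 1)" by metis
    then show ?thesis unfolding mu_3_def by simp
  qed
  ultimately show ?thesis using countable_rep_eq uncountable_mu_4 uncountable_mu_min by auto
qed

end
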